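(* Work in ZF. Suppose \(\delta\) and \(\epsilon\) are ordinals, \(\mathcal U\) is a nonprincipal normal fine ultrafilter on \(P(\delta)\), and \(F\) is an \(\epsilon\)-complete filter on \(\delta\) with \(F\in\mathcal U\) (viewing \(F\subseteq P(\delta)\)). Suppose there is a wellfounded \(\kappa_{\mathcal U}^+\)-complete fine ultrafilter \(\mathcal W\) on \(P(P(\delta))\) that concentrates on the set of \(\sigma\subseteq P(\delta)\) such that \(\aleph(P(\sigma))<\epsilon\). Then \(\delta\) can be partitioned into fewer than \(\kappa_{\mathcal U}\)-many atoms of \(F\).
   Context: An ultrafilter \(\mathcal U\) on \(P(\delta)\) is fine if \(\{\sigma\subseteq\delta:x\in\sigma\}\in\mathcal U\) for all \(x<\delta\), and normal if for every \(\langle A_x:x<\delta\rangle\subseteq\mathcal U\), the diagonal intersection \(\{\sigma\subseteq\delta:\sigma\in\bigcap_{x\in\sigma}A_x\}\) is in \(\mathcal U\). A filter is \(\kappa\)-complete if closed under intersections of sequences of its members of length less than \(\kappa\); \(\kappa_{\mathcal U}\) is the largest cardinal \(\kappa\) such that \(\mathcal U\) is \(\kappa\)-complete, and \(\kappa_{\mathcal U}^+\) the least cardinal above it. \(\mathcal W\) on \(P(P(\delta))\) is fine if \(\{\sigma\subseteq P(\delta):A\in\sigma\}\in\mathcal W\) for all \(A\subseteq\delta\). A filter \(G\) on a set \(Y\) is wellfounded if for every ordinal \(\gamma\) the reduced power \(\gamma^Y/G\) is wellfounded. \(\aleph(Z)\), the Hartogs number, is the least ordinal not injecting into \(Z\).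 An atom of \(F\) is an \(F\)-positive set \(A\) (meeting every member of \(F\)) such that the filter generated by \(F\cup\{A\}\) is an ultrafilter. "Fewer than \(\kappa_{\mathcal U}\)-many" means the partition is in bijection with an ordinal less than \(\kappa_{\mathcal U}\). *)

theory Defs
  imports Main
begin

text \<open>
  HOL has global choice, so working in ZF is rendered by working in an arbitrary model of ZF: a
  type with a binary relation that satisfies the ZF axioms, Separation and Replacement being the
  genuine schemata over first-order formulas with parameters (no choice, and no second-order
  comprehension).  By the completeness theorem, truth in all such models is provability in ZF.
  Every definition below quantifies over elements of the model only, i.e. is the relativisation of
  the corresponding first-order formula to the model.
\<close>

subsection \<open>The language of set theory and the axioms of ZF\<close>

datatype fm = FMem nat nat | FEq nat nat | FNeg fm | FConj fm fm | FAll nat fm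

primrec sat :: "('v \<Rightarrow> 'v \<Rightarrow> bool) \<Rightarrow> (nat \<Rightarrow> 'v) \<Rightarrow> fm \<Rightarrow> bool" where
  "sat E e (FMem i j) \<longleftrightarrow> E (e i) (e j)"
| "sat E e (FEq i j) \<longleftrightarrow> e i = e j"
| "sat E e (FNeg p) \<longleftrightarrow> \<not> sat E e p"
| "sat E e (FConj p q) \<longleftrightarrow> sat E e p \<and> sat E e q"
| "sat E e (FAll i p) \<longleftrightarrow> (\<forall>x. sat E (e(i := x)) p)"

class vmem =
  fixes vmem :: "'a \<Rightarrow> 'a \<Rightarrow> bool"  (infix "\<in>\<^sub>V" 50)

text \<open>In the two schemata the environment \<open>e\<close> supplies the parameters of the formula \<open>p\<close>.\<close>

class zf = vmem +
  assumes extensionality: "(\<forall>z. z \<in>\<^sub>V x \<longleftrightarrow> z \<in>\<^sub>V y) \<Longrightarrow> x = y"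
    and foundation: "\<exists>y. y \<in>\<^sub>V x \<Longrightarrow> \<exists>y. y \<in>\<^sub>V x \<and> (\<forall>z. z \<in>\<^sub>V x \<longrightarrow> \<not> z \<in>\<^sub>V y)"
    and pairing: "\<exists>z. \<forall>w. w \<in>\<^sub>V z \<longleftrightarrow> w = x \<or> w = y"
    and union: "\<exists>z. \<forall>w. w \<in>\<^sub>V z \<longleftrightarrow> (\<exists>y. y \<in>\<^sub>V x \<and> w \<in>\<^sub>V y)"
    and power_set: "\<exists>z. \<forall>w. w \<in>\<^sub>V z \<longleftrightarrow> (\<forall>u. u \<in>\<^sub>V w \<longrightarrow> u \<in>\<^sub>V x)"
    and infinity: "\<exists>w. (\<exists>z. z \<in>\<^sub>V w \<and> (\<forall>u. \<not> u \<in>\<^sub>V z)) \<and>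
      (\<forall>x. x \<in>\<^sub>V w \<longrightarrow> (\<exists>y. y \<in>\<^sub>V w \<and> (\<forall>u. u \<in>\<^sub>V y \<longleftrightarrow> u \<in>\<^sub>V x \<or> u = x)))"
    and separation: "\<exists>b. \<forall>x. x \<in>\<^sub>V b \<longleftrightarrow> x \<in>\<^sub>V a \<and> sat (\<in>\<^sub>V) (e(0 := x)) p"
    and replacement:
      "(\<forall>x y z. x \<in>\<^sub>V a \<and> sat (\<in>\<^sub>V) (e(0 := x, 1 := y)) p \<and> sat (\<in>\<^sub>V) (e(0 := x, 1 := z)) p
          \<longrightarrow> y = z) \<Longrightarrow>
       \<exists>b. \<forall>y. y \<in>\<^sub>V b \<longleftrightarrow> (\<exists>x. x \<in>\<^sub>V a \<and> sat (\<in>\<^sub>V) (e(0 := x, 1 := y)) p)"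


subsection \<open>Basic set-theoretic vocabulary inside the model\<close>

text \<open>
  \<open>Coll P\<close> is the element of the model whose elements are exactly those satisfying \<open>P\<close>.  It is
  meaningful only if there is such an element; it is applied below only to classes that ZF proves
  to be sets.
\<close>

definition Coll :: "('v::zf \<Rightarrow> bool) \<Rightarrow> 'v" where
  "Coll P = (THE b. \<forall>x. x \<in>\<^sub>V b \<longleftrightarrow> P x)"

lemma mem_Coll_iff:
  assumes "\<exists>b. \<forall>x. x \<in>\<^sub>V b \<longleftrightarrow> P x"
  shows "x \<in>\<^sub>V Coll P \<longleftrightarrow> P x"
proof -
  have "\<exists>!b. \<forall>x. x \<in>\<^sub>V b \<longleftrightarrow> P x"
    using assms extensionality by metis
  then have "\<forall>x. x \<in>\<^sub>V Coll P \<longleftrightarrow> P x"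
    unfolding Coll_def by (rule theI')
  then show ?thesis by blast
qed

definition Sep :: "'v::zf \<Rightarrow> ('v \<Rightarrow> bool) \<Rightarrow> 'v" where
  "Sep a P = Coll (\<lambda>x. x \<in>\<^sub>V a \<and> P x)"

definition vsubset :: "'v::zf \<Rightarrow> 'v \<Rightarrow> bool"  (infix "\<subseteq>\<^sub>V" 50) where
  "a \<subseteq>\<^sub>V b \<longleftrightarrow> (\<forall>x. x \<in>\<^sub>V a \<longrightarrow> x \<in>\<^sub>V b)"

definition nonempty :: "'v::zf \<Rightarrow> bool" where
  "nonempty a \<longleftrightarrow> (\<exists>x. x \<in>\<^sub>V a)"

definition vpow :: "'v::zf \<Rightarrow> 'v" where
  "vpow a = Coll (\<lambda>x. x \<subseteq>\<^sub>V a)"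

definition upair :: "'v::zf \<Rightarrow> 'v \<Rightarrow> 'v" where
  "upair x y = Coll (\<lambda>z. z = x \<or> z = y)"

definition opair :: "'v::zf \<Rightarrow> 'v \<Rightarrow> 'v" where
  "opair x y = upair (upair x x) (upair x y)"

definition is_fun :: "'v::zf \<Rightarrow> 'v \<Rightarrow> 'v \<Rightarrow> bool" where
  "is_fun f a b \<longleftrightarrow>
    (\<forall>p. p \<in>\<^sub>V f \<longrightarrow> (\<exists>x y. x \<in>\<^sub>V a \<and> y \<in>\<^sub>V b \<and> p = opair x y)) \<and>
    (\<forall>x. x \<in>\<^sub>V a \<longrightarrow> (\<exists>!y. opair x y \<in>\<^sub>V f))"

definition app :: "'v::zf \<Rightarrow> 'v \<Rightarrow> 'v" where
  "app f x = (THE y. opair x y \<in>\<^sub>V f)"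

definition is_inj :: "'v::zf \<Rightarrow> 'v \<Rightarrow> 'v \<Rightarrow> bool" where
  "is_inj f a b \<longleftrightarrow> is_fun f a b \<and>
    (\<forall>x y. x \<in>\<^sub>V a \<and> y \<in>\<^sub>V a \<and> app f x = app f y \<longrightarrow> x = y)"

definition is_bij :: "'v::zf \<Rightarrow> 'v \<Rightarrow> 'v \<Rightarrow> bool" where
  "is_bij f a b \<longleftrightarrow> is_inj f a b \<and> (\<forall>y. y \<in>\<^sub>V b \<longrightarrow> (\<exists>x. x \<in>\<^sub>V a \<and> app f x = y))"

definition funspace :: "'v::zf \<Rightarrow> 'v \<Rightarrow> 'v" where
  "funspace a b = Coll (\<lambda>f. is_fun f a b)"


subsection \<open>Ordinals and cardinals\<close>

text \<open>Transitive sets that are strictly well-ordered by membership.\<close>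

definition Ord :: "'v::zf \<Rightarrow> bool" where
  "Ord \<alpha> \<longleftrightarrow>
    (\<forall>x. x \<in>\<^sub>V \<alpha> \<longrightarrow> x \<subseteq>\<^sub>V \<alpha>) \<and>
    (\<forall>x. x \<in>\<^sub>V \<alpha> \<longrightarrow> \<not> x \<in>\<^sub>V x) \<and>
    (\<forall>x y z. x \<in>\<^sub>V \<alpha> \<and> y \<in>\<^sub>V \<alpha> \<and> z \<in>\<^sub>V \<alpha> \<and> x \<in>\<^sub>V y \<and> y \<in>\<^sub>V z \<longrightarrow> x \<in>\<^sub>V z) \<and>
    (\<forall>x y. x \<in>\<^sub>V \<alpha> \<and> y \<in>\<^sub>V \<alpha> \<longrightarrow> x \<in>\<^sub>V y \<or> x = y \<or> y \<in>\<^sub>V x) \<and>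
    (\<forall>s. s \<subseteq>\<^sub>V \<alpha> \<and> nonempty s \<longrightarrow> (\<exists>m. m \<in>\<^sub>V s \<and> (\<forall>x. x \<in>\<^sub>V s \<longrightarrow> \<not> x \<in>\<^sub>V m)))"

definition Card :: "'v::zf \<Rightarrow> bool" where
  "Card \<kappa> \<longleftrightarrow> Ord \<kappa> \<and> (\<forall>\<beta>. \<beta> \<in>\<^sub>V \<kappa> \<longrightarrow> \<not> (\<exists>f. is_bij f \<beta> \<kappa>))"

definition least_ord :: "('v::zf \<Rightarrow> bool) \<Rightarrow> 'v" where
  "least_ord P = (THE \<alpha>. Ord \<alpha> \<and> P \<alpha> \<and> (\<forall>\<beta>. \<beta> \<in>\<^sub>V \<alpha> \<longrightarrow> \<not> P \<beta>))"

definition card_succ :: "'v::zf \<Rightarrow> 'v" where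
  "card_succ \<kappa> = least_ord (\<lambda>\<mu>. Card \<mu> \<and> \<kappa> \<in>\<^sub>V \<mu>)"

definition hartogs :: "'v::zf \<Rightarrow> 'v" where
  "hartogs Z = least_ord (\<lambda>\<alpha>. \<not> (\<exists>f. is_inj f \<alpha> Z))"


subsection \<open>Filters\<close>

text \<open>Filters are proper.\<close>

definition filter_on :: "'v::zf \<Rightarrow> 'v \<Rightarrow> bool" where
  "filter_on Y F \<longleftrightarrow>
    F \<subseteq>\<^sub>V vpow Y \<and> Y \<in>\<^sub>V F \<and> (\<forall>A. A \<in>\<^sub>V F \<longrightarrow> nonempty A) \<and>
    (\<forall>A B. A \<in>\<^sub>V F \<and> A \<subseteq>\<^sub>V B \<and> B \<subseteq>\<^sub>V Y \<longrightarrow> B \<in>\<^sub>V F) \<and>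
    (\<forall>A B. A \<in>\<^sub>V F \<and> B \<in>\<^sub>V F \<longrightarrow> Sep A (\<lambda>x. x \<in>\<^sub>V B) \<in>\<^sub>V F)"

definition ultrafilter_on :: "'v::zf \<Rightarrow> 'v \<Rightarrow> bool" where
  "ultrafilter_on Y U \<longleftrightarrow> filter_on Y U \<and>
    (\<forall>A. A \<subseteq>\<^sub>V Y \<longrightarrow> A \<in>\<^sub>V U \<or> Sep Y (\<lambda>x. \<not> x \<in>\<^sub>V A) \<in>\<^sub>V U)"

definition is_principal :: "'v::zf \<Rightarrow> 'v \<Rightarrow> bool" where
  "is_principal Y U \<longleftrightarrow> (\<exists>y. y \<in>\<^sub>V Y \<and> U = Sep (vpow Y) (\<lambda>A. y \<in>\<^sub>V A))"

text \<open>Fineness and normality concern families of subsets of \<open>vpow Z\<close>.\<close>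

definition is_fine :: "'v::zf \<Rightarrow> 'v \<Rightarrow> bool" where
  "is_fine Z U \<longleftrightarrow> (\<forall>x. x \<in>\<^sub>V Z \<longrightarrow> Sep (vpow Z) (\<lambda>\<sigma>. x \<in>\<^sub>V \<sigma>) \<in>\<^sub>V U)"

definition is_normal :: "'v::zf \<Rightarrow> 'v \<Rightarrow> bool" where
  "is_normal Z U \<longleftrightarrow> (\<forall>A. is_fun A Z U \<longrightarrow>
    Sep (vpow Z) (\<lambda>\<sigma>. \<forall>x. x \<in>\<^sub>V \<sigma> \<longrightarrow> \<sigma> \<in>\<^sub>V app A x) \<in>\<^sub>V U)"

text \<open>The intersection of the empty sequence of subsets of \<open>Y\<close> is \<open>Y\<close>.\<close>

definition is_complete :: "'v::zf \<Rightarrow> 'v \<Rightarrow> 'v \<Rightarrow> bool" where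
  "is_complete Y F \<kappa> \<longleftrightarrow> (\<forall>\<beta> A. \<beta> \<in>\<^sub>V \<kappa> \<and> is_fun A \<beta> F \<longrightarrow>
    Sep Y (\<lambda>y. \<forall>i. i \<in>\<^sub>V \<beta> \<longrightarrow> y \<in>\<^sub>V app A i) \<in>\<^sub>V F)"

text \<open>
  The largest cardinal \<open>\<kappa>\<close> such that the filter \<open>U\<close> on \<open>Y\<close> is \<open>\<kappa>\<close>-complete.  It exists if \<open>U\<close> is
  a nonprincipal fine ultrafilter on the power set of an ordinal \<open>\<delta>\<close>: such a \<open>U\<close> is not closed
  under intersections of length \<open>\<delta>\<close>, as the intersection of the sets given by fineness is the
  singleton of \<open>\<delta>\<close>.
\<close>

definition completeness :: "'v::zf \<Rightarrow> 'v \<Rightarrow> 'v" where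
  "completeness Y U = (THE \<kappa>. Card \<kappa> \<and> is_complete Y U \<kappa> \<and>
    (\<forall>\<mu>. Card \<mu> \<and> is_complete Y U \<mu> \<longrightarrow> \<mu> \<in>\<^sub>V \<kappa> \<or> \<mu> = \<kappa>))"

definition is_positive :: "'v::zf \<Rightarrow> 'v \<Rightarrow> 'v \<Rightarrow> bool" where
  "is_positive Y F A \<longleftrightarrow> A \<subseteq>\<^sub>V Y \<and> (\<forall>B. B \<in>\<^sub>V F \<longrightarrow> (\<exists>y. y \<in>\<^sub>V A \<and> y \<in>\<^sub>V B))"

text \<open>\<open>G\<close> is the least filter on \<open>Y\<close> that includes \<open>S\<close>.\<close>

definition is_generated_filter :: "'v::zf \<Rightarrow> 'v \<Rightarrow> 'v \<Rightarrow> bool" where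
  "is_generated_filter Y S G \<longleftrightarrow> filter_on Y G \<and> S \<subseteq>\<^sub>V G \<and>
    (\<forall>H. filter_on Y H \<and> S \<subseteq>\<^sub>V H \<longrightarrow> G \<subseteq>\<^sub>V H)"

definition is_atom :: "'v::zf \<Rightarrow> 'v \<Rightarrow> 'v \<Rightarrow> bool" where
  "is_atom Y F A \<longleftrightarrow> is_positive Y F A \<and>
    (\<exists>G. is_generated_filter Y (Coll (\<lambda>B. B \<in>\<^sub>V F \<or> B = A)) G \<and> ultrafilter_on Y G)"

definition is_partition :: "'v::zf \<Rightarrow> 'v \<Rightarrow> bool" where
  "is_partition Y P \<longleftrightarrow>
    (\<forall>A. A \<in>\<^sub>V P \<longrightarrow> A \<subseteq>\<^sub>V Y \<and> nonempty A) \<and>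
    (\<forall>A B. A \<in>\<^sub>V P \<and> B \<in>\<^sub>V P \<and> A \<noteq> B \<longrightarrow> \<not> (\<exists>y. y \<in>\<^sub>V A \<and> y \<in>\<^sub>V B)) \<and>
    (\<forall>y. y \<in>\<^sub>V Y \<longrightarrow> (\<exists>A. A \<in>\<^sub>V P \<and> y \<in>\<^sub>V A))"


subsection \<open>Reduced powers\<close>

text \<open>
  The reduced power of an ordinal \<open>\<gamma>\<close> by a filter \<open>G\<close> on \<open>Y\<close>: its elements are the equivalence
  classes of functions from \<open>Y\<close> to \<open>\<gamma>\<close> modulo equality on a set in \<open>G\<close>, and it is ordered by the
  membership relation on a set in \<open>G\<close>.
\<close>

definition rp_class :: "'v::zf \<Rightarrow> 'v \<Rightarrow> 'v \<Rightarrow> 'v \<Rightarrow> 'v" where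
  "rp_class Y G \<gamma> f = Sep (funspace Y \<gamma>) (\<lambda>g. Sep Y (\<lambda>y. app f y = app g y) \<in>\<^sub>V G)"

definition reduced_power :: "'v::zf \<Rightarrow> 'v \<Rightarrow> 'v \<Rightarrow> 'v" where
  "reduced_power Y G \<gamma> = Coll (\<lambda>c. \<exists>f. f \<in>\<^sub>V funspace Y \<gamma> \<and> c = rp_class Y G \<gamma> f)"

definition rp_less :: "'v::zf \<Rightarrow> 'v \<Rightarrow> 'v \<Rightarrow> 'v \<Rightarrow> bool" where
  "rp_less Y G c d \<longleftrightarrow>
    (\<exists>f g. f \<in>\<^sub>V c \<and> g \<in>\<^sub>V d \<and> Sep Y (\<lambda>y. app f y \<in>\<^sub>V app g y) \<in>\<^sub>V G)"

text \<open>
  In the absence of dependent choice, wellfoundedness means that nonempty subsets have minimal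
  elements.
\<close>

definition is_wellfounded_filter :: "'v::zf \<Rightarrow> 'v \<Rightarrow> bool" where
  "is_wellfounded_filter Y G \<longleftrightarrow> (\<forall>\<gamma>. Ord \<gamma> \<longrightarrow>
    (\<forall>S. S \<subseteq>\<^sub>V reduced_power Y G \<gamma> \<and> nonempty S \<longrightarrow>
      (\<exists>c. c \<in>\<^sub>V S \<and> (\<forall>d. d \<in>\<^sub>V S \<longrightarrow> \<not> rp_less Y G d c))))"

end

theory Submission
  imports Defs
begin

text \<open>
  A set \<open>\<sigma>\<close> of subsets of \<open>\<delta>\<close> partitions \<open>\<delta>\<close> into the classes of points that lie in the same members
  of \<open>\<sigma>\<close>.  For \<open>W\<close>-almost all \<open>\<sigma>\<close> the union of the \<open>F\<close>-null classes is null, by the completeness of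
  \<open>F\<close>, and there are fewer than \<open>\<kappa>\<^bsub>U\<^esub>\<close> positive classes: as \<open>F \<in> U\<close>, a disjoint family of \<open>\<kappa>\<^bsub>U\<^esub>\<close>
  positive sets would contradict normality.  List the positive classes of \<open>\<sigma>\<close> in the order of their
  least elements.  The \<open>W\<close>-limit of the \<open>i\<close>-th positive classes is an ultrafilter \<open>U\<^sub>i\<close> on \<open>\<delta>\<close>, and \<open>F\<close>
  is the intersection of the \<open>U\<^sub>i\<close>.  By fineness and completeness of \<open>W\<close>, almost every \<open>\<sigma>\<close> separates
  any two distinct \<open>U\<^sub>i\<close>; hence each of its positive classes lies in only one ultrafilter \<open>U\<^sub>i\<close>, that
  is, it is an atom of \<open>F\<close>.

  Inside a model of ZF, every set used has to be obtained from Separation or Replacement for a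
  first-order formula; the predicate \<open>fo\<close> and its introduction rules discharge these conditions.
\<close>

subsection \<open>First-order definability with parameters\<close>

text \<open>Two steps must do without choice, and this shapes the argument. A positive class is
  represented by its least element, so the classes of one \<sigma> are listed canonically and the
  limits \<open>U\<^sub>i\<close> arise without picking points. For distinct
  \<open>U\<^sub>i\<close> and \<open>U\<^sub>j\<close> one would like to fix a set A separating
  them, but \<open>vpow \<delta>\<close> need not be wellorderable, so such sets cannot be chosen
  for all pairs of indices at once. Instead \<open>separated i j \<sigma>\<close> records only the
  effect on \<sigma> of having such an A as a member. One A proves it for almost all \<sigma>, and
  the statement itself, free of A, is intersected over all i and j in \<kappa>. The indices run
  through all of \<kappa> because the number of positive classes depends on \<sigma>; intersections
  of length exactly \<kappa> are taken, which is why W is complete for the successor of \<kappa>.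
  The bound on that number comes from \<kappa> being a length at which completeness of U fails: a
  sequence witnessing the failure, diagonalised by normality, shows that the sets s including
  \<kappa> do not form a member of U.\<close>

definition trm :: "((nat \<Rightarrow> 'v) \<Rightarrow> 'v) \<Rightarrow> bool" where
  "trm t \<longleftrightarrow> (\<exists>i. t = (\<lambda>e. e i)) \<or> (\<exists>a. t = (\<lambda>_. a))"

text \<open>A semantic counterpart of formulas: predicates on environments with de Bruijn indices,
  place 0 holding the variable bound last. Elements of the model enter as constants through
  \<open>trm\<close>, so instances of Separation are justified by introduction rules, without
  writing codes of formulas.\<close>

inductive fo :: "((nat \<Rightarrow> 'v::zf) \<Rightarrow> bool) \<Rightarrow> bool" where
  fo_mem0: "trm s \<Longrightarrow> trm t \<Longrightarrow> fo (\<lambda>e. s e \<in>\<^sub>V t e)"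
| fo_eq0: "trm s \<Longrightarrow> trm t \<Longrightarrow> fo (\<lambda>e. s e = t e)"
| fo_neg: "fo P \<Longrightarrow> fo (\<lambda>e. \<not> P e)"
| fo_conj: "fo P \<Longrightarrow> fo Q \<Longrightarrow> fo (\<lambda>e. P e \<and> Q e)"
| fo_all0: "fo P \<Longrightarrow> fo (\<lambda>e. \<forall>x. P (case_nat x e))"

lemma fo_subst: "fo P \<Longrightarrow> (\<And>i. trm (\<lambda>e. s e i)) \<Longrightarrow> fo (\<lambda>e. P (s e))"
proof (induction P arbitrary: s rule: fo.induct)
  case (fo_mem0 u t)
  have "trm (\<lambda>e. u (s e))" "trm (\<lambda>e. t (s e))"
    using fo_mem0 by (auto simp: trm_def)
  then show ?case by (rule fo.fo_mem0)
next
  case (fo_eq0 u t)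
  have "trm (\<lambda>e. u (s e))" "trm (\<lambda>e. t (s e))"
    using fo_eq0 by (auto simp: trm_def)
  then show ?case by (rule fo.fo_eq0)
next
  case (fo_neg P)
  then show ?case using fo.fo_neg[of "\<lambda>e. P (s e)"] by blast
next
  case (fo_conj P Q)
  then show ?case using fo.fo_conj[of "\<lambda>e. P (s e)" "\<lambda>e. Q (s e)"] by blast
next
  case (fo_all0 P)
  \<comment> \<open>The substitution is lifted under the quantifier: place 0 is kept, and the old
    entries read the environment shifted by one.\<close>
  let ?s = "\<lambda>e. case_nat (e 0) (s (\<lambda>i. e (Suc i)))"
  have "trm (\<lambda>e. ?s e i)" for i
  proof (cases i)
    case 0
    then show ?thesis by (auto simp: trm_def)
  next
    case (Suc n)
    have "trm (\<lambda>e. s e n)" by (rule fo_all0.prems)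
    then show ?thesis unfolding trm_def
    proof
      assume "\<exists>j. (\<lambda>e. s e n) = (\<lambda>e. e j)"
      then obtain j where "\<And>e. s e n = e j" by metis
      then have "(\<lambda>e. ?s e i) = (\<lambda>e. e (Suc j))" using Suc by auto
      then show "(\<exists>j. (\<lambda>e. ?s e i) = (\<lambda>e. e j)) \<or> (\<exists>a. (\<lambda>e. ?s e i) = (\<lambda>_. a))" by blast
    next
      assume "\<exists>a. (\<lambda>e. s e n) = (\<lambda>_. a)"
      then obtain a where "\<And>e. s e n = a" by metis
      then have "(\<lambda>e. ?s e i) = (\<lambda>_. a)" using Suc by auto
      then show "(\<exists>j. (\<lambda>e. ?s e i) = (\<lambda>e. e j)) \<or> (\<exists>a. (\<lambda>e. ?s e i) = (\<lambda>_. a))" by blast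
    qed
  qed
  then have "fo (\<lambda>e. P (?s e))" by (rule fo_all0.IH)
  from fo.fo_all0[OF this] show ?case by simp
qed

lemma fo_rename: "fo P \<Longrightarrow> fo (\<lambda>e. P (\<lambda>i. e (r i)))"
  by (rule fo_subst) (auto simp: trm_def)

section \<open>From definable predicates to formulas and the two schemata\<close>

primrec ren :: "(nat \<Rightarrow> nat) \<Rightarrow> fm \<Rightarrow> fm" where
  "ren r (FMem i j) = FMem (r i) (r j)"
| "ren r (FEq i j) = FEq (r i) (r j)"
| "ren r (FNeg p) = FNeg (ren r p)"
| "ren r (FConj p q) = FConj (ren r p) (ren r q)"
| "ren r (FAll i p) = FAll (r i) (ren r p)"

text \<open>Injectivity keeps the update of a renamed bound variable from touching any other
  variable.\<close>

lemma sat_ren: "inj r \<Longrightarrow> sat E e (ren r p) = sat E (e \<circ> r) p"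
proof (induction p arbitrary: e)
  case (FAll i p)
  have "(e(r i := x)) \<circ> r = (e \<circ> r)(i := x)" for x
    using FAll.prems by (auto simp: fun_eq_iff inj_eq)
  then show ?case using FAll by (simp add: o_def del: fun_upd_apply)
qed (simp_all add: o_def)

text \<open>Variables at the even places of the environment, parameters at the odd places: this leaves
  room for new parameters and bound variables under injective renamings.\<close>

definition mix :: "(nat \<Rightarrow> 'v) \<Rightarrow> (nat \<Rightarrow> 'v) \<Rightarrow> nat \<Rightarrow> 'v" where
  "mix c e n = (if even n then e (n div 2) else c (n div 2))"

lemma trm_mix: "trm t \<Longrightarrow> \<exists>i a. \<forall>c e. c k = a \<longrightarrow> t e = mix c e i"
  unfolding trm_def
proof (elim disjE exE)
  fix i assume "t = (\<lambda>e. e i)"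
  then show ?thesis by (intro exI[of _ "2 * i"]) (simp add: mix_def)
next
  fix a assume "t = (\<lambda>_. a)"
  then show ?thesis by (intro exI[of _ "2 * k + 1"]) (auto simp: mix_def)
qed

lemma fo_sat: "fo P \<Longrightarrow> \<exists>p c. \<forall>e. P e \<longleftrightarrow> sat (\<in>\<^sub>V) (mix c e) p"
proof (induction P rule: fo.induct)
  case (fo_mem0 s t)
  obtain i a where s: "\<And>c e. c 0 = a \<Longrightarrow> s e = mix c e i" using trm_mix[OF fo_mem0(1), of 0] by metis
  obtain j b where t: "\<And>c e. c 1 = b \<Longrightarrow> t e = mix c e j" using trm_mix[OF fo_mem0(2), of 1] by metis
  show ?case
    by (rule exI[of _ "FMem i j"], rule exI[of _ "\<lambda>n. if n = 0 then a else b"])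
      (simp add: s[of "\<lambda>n. if n = 0 then a else b"] t[of "\<lambda>n. if n = 0 then a else b"])
next
  case (fo_eq0 s t)
  obtain i a where s: "\<And>c e. c 0 = a \<Longrightarrow> s e = mix c e i" using trm_mix[OF fo_eq0(1), of 0] by metis
  obtain j b where t: "\<And>c e. c 1 = b \<Longrightarrow> t e = mix c e j" using trm_mix[OF fo_eq0(2), of 1] by metis
  show ?case
    by (rule exI[of _ "FEq i j"], rule exI[of _ "\<lambda>n. if n = 0 then a else b"])
      (simp add: s[of "\<lambda>n. if n = 0 then a else b"] t[of "\<lambda>n. if n = 0 then a else b"])
next
  case (fo_neg P)
  then show ?case by (metis sat.simps(3))
next
  case (fo_conj P Q)
  then obtain p c q d where p: "\<And>e. P e \<longleftrightarrow> sat (\<in>\<^sub>V) (mix c e) p"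
    and q: "\<And>e. Q e \<longleftrightarrow> sat (\<in>\<^sub>V) (mix d e) q" by blast
  \<comment> \<open>The two parameter lists are interleaved: \<open>r\<close> moves parameter k of
    \<open>p\<close> from place 2k+1 to 4k+1, \<open>s\<close> moves that of \<open>q\<close> to
    4k+3, and both fix the even places.\<close>
  define b where "b = (\<lambda>n. if even n then c (n div 2) else d (n div 2))"
  define r where "r = (\<lambda>n::nat. if even n then n else 2 * n - 1)"
  define s where "s = (\<lambda>n::nat. if even n then n else 2 * n + 1)"
  have inj: "inj r" "inj s" unfolding r_def s_def inj_def by (auto split: if_splits; presburger)+
  have "mix b e (r n) = mix c e n" "mix b e (s n) = mix d e n" for e n
    by (cases "even n"; elim evenE oddE; simp add: mix_def b_def r_def s_def)+
  then have "mix b e \<circ> r = mix c e" "mix b e \<circ> s = mix d e" for e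
    by (simp_all add: fun_eq_iff)
  then have "P e \<and> Q e \<longleftrightarrow> sat (\<in>\<^sub>V) (mix b e) (FConj (ren r p) (ren s q))" for e
    by (simp add: p q sat_ren inj)
  then show ?case by blast
next
  case (fo_all0 P)
  then obtain p c where p: "\<And>e. P e \<longleftrightarrow> sat (\<in>\<^sub>V) (mix c e) p" by blast
  \<comment> \<open>The bound variable at place 0 moves to the odd place 1. The other variables move
    down by one even place, and the parameters up by one odd place to vacate place 1; the entry that
    \<open>c (n - 1)\<close> leaves there is overwritten by the quantifier.\<close>
  define r where "r = (\<lambda>n::nat. if n = 0 then 1 else if even n then n - 2 else n + 2)"
  have "inj r" unfolding r_def inj_def by (auto split: if_splits; presburger)
  moreover have "(mix (\<lambda>n. c (n - 1)) e)(1 := x) \<circ> r = mix c (case_nat x e)" for e x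
    by (auto simp: fun_eq_iff mix_def r_def elim!: oddE evenE split: nat.split)
  ultimately have "(\<forall>x. P (case_nat x e)) \<longleftrightarrow> sat (\<in>\<^sub>V) (mix (\<lambda>n. c (n - 1)) e) (FAll 1 (ren r p))" for e
    by (simp add: p sat_ren del: fun_upd_apply)
  then show ?case by blast
qed

lemma fo_separation:
  assumes "fo P" shows "\<exists>b. \<forall>x. x \<in>\<^sub>V b \<longleftrightarrow> x \<in>\<^sub>V a \<and> P (case_nat x e)"
proof -
  obtain p c where p: "\<And>e. P e \<longleftrightarrow> sat (\<in>\<^sub>V) (mix c e) p" using fo_sat[OF assms] by blast
  define m where "m = mix c (case_nat undefined e)"
  have "mix c (case_nat x e) = m(0 := x)" for x
    by (auto simp: fun_eq_iff mix_def m_def elim!: evenE split: nat.split)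
  then show ?thesis using separation[of a m p] by (simp add: p del: fun_upd_apply)
qed

lemma fo_replacement:
  assumes "fo (\<lambda>e. R (e 0) (e 1))" and "\<And>x y z. x \<in>\<^sub>V a \<Longrightarrow> R x y \<Longrightarrow> R x z \<Longrightarrow> y = z"
  shows "\<exists>b. \<forall>y. y \<in>\<^sub>V b \<longleftrightarrow> (\<exists>x. x \<in>\<^sub>V a \<and> R x y)"
proof -
  obtain p c where p: "\<And>e. R (e 0) (e 1) \<longleftrightarrow> sat (\<in>\<^sub>V) (mix c e) p"
    using fo_sat[OF assms(1)] by blast
  \<comment> \<open>Replacement reads its second argument at place 1, but \<open>mix\<close> keeps
    variable 1 at place 2; \<open>r\<close> exchanges these places.\<close>
  define r where "r = (\<lambda>n::nat. if n = 1 then 2 else if n = 2 then 1 else n)"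
  have r: "inj r" unfolding r_def inj_def by (auto split: if_splits)
  define e where "e = (\<lambda>n. (mix c undefined) (r n))"
  have "e(0 := x, 1 := y) \<circ> r = mix c (\<lambda>n. if n = 0 then x else if n = 1 then y else undefined n)" for x y
    by (auto simp: fun_eq_iff mix_def e_def r_def elim!: evenE)
  then have "R x y \<longleftrightarrow> sat (\<in>\<^sub>V) (e(0 := x, 1 := y)) (ren r p)" for x y
    using p[of "(\<lambda>n. if n = 0 then x else if n = 1 then y else undefined n)"]
    by (simp add: sat_ren[OF r] del: fun_upd_apply)
  then show ?thesis using replacement[of a e "ren r p"] assms(2) by (simp del: fun_upd_apply) blast
qed

section \<open>Definable terms and closure rules\<close>

text \<open>Terms such as \<open>Sep\<close> and \<open>hartogs\<close> do not belong to the
  language, so a definable term is handled through its graph, with the value at place 0.\<close>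

definition fot :: "((nat \<Rightarrow> 'v::zf) \<Rightarrow> 'v) \<Rightarrow> bool" where
  "fot t \<longleftrightarrow> fo (\<lambda>e. e 0 = t (\<lambda>i. e (Suc i)))"

named_theorems fo_rules

lemma fo_not [fo_rules]: "fo P \<Longrightarrow> fo (\<lambda>e. \<not> P e)"
  by (rule fo_neg)

lemma fo_and [fo_rules]: "fo P \<Longrightarrow> fo Q \<Longrightarrow> fo (\<lambda>e. P e \<and> Q e)"
  by (rule fo_conj)

lemma fo_or [fo_rules]: "fo P \<Longrightarrow> fo Q \<Longrightarrow> fo (\<lambda>e. P e \<or> Q e)"
  using fo_neg[OF fo_conj[OF fo_neg fo_neg], of P Q] by simp

lemma fo_imp [fo_rules]: "fo P \<Longrightarrow> fo Q \<Longrightarrow> fo (\<lambda>e. P e \<longrightarrow> Q e)"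
  using fo_neg[OF fo_conj[OF _ fo_neg], of P Q] by simp

lemma fo_iff [fo_rules]:
  assumes "fo P" "fo Q" shows "fo (\<lambda>e. P e \<longleftrightarrow> Q e)"
  unfolding iff_conv_conj_imp by (intro fo_and fo_imp assms)

lemma fo_all [fo_rules]: "fo (\<lambda>e. P (e 0) (\<lambda>i. e (Suc i))) \<Longrightarrow> fo (\<lambda>e. \<forall>x. P x e)"
  using fo_all0[of "\<lambda>e. P (e 0) (\<lambda>i. e (Suc i))"] by simp

lemma fo_ex [fo_rules]: "fo (\<lambda>e. P (e 0) (\<lambda>i. e (Suc i))) \<Longrightarrow> fo (\<lambda>e. \<exists>x. P x e)"
  using fo_neg[OF fo_all[OF fo_neg], of P] by simp

lemma fo_const [fo_rules]: "fo (\<lambda>e. b)"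
proof -
  have "fo (\<lambda>e. e 0 = e 0)" by (rule fo_eq0) (auto simp: trm_def)
  then have "fo (\<lambda>e. True)" by simp
  with fo_neg[OF this] show ?thesis by (cases b) auto
qed

lemma fot_const [fo_rules]: "fot (\<lambda>e. a)"
  unfolding fot_def by (rule fo_eq0) (auto simp: trm_def)

lemma fot_var [fo_rules]: "fot (\<lambda>e. e i)"
  unfolding fot_def by (rule fo_eq0) (auto simp: trm_def)

lemma fot_rename: "fot t \<Longrightarrow> fot (\<lambda>e. t (\<lambda>i. e (r i)))"
  unfolding fot_def
  by (drule fo_rename[where r = "case_nat 0 (\<lambda>i. Suc (r i))"]) simp

text \<open>The term is eliminated by quantifying over its value, so definability of its graph
  suffices.\<close>

lemma fo_subst1:
  assumes "fo (\<lambda>e. P (e 0) (\<lambda>i. e (Suc i)))" and "fot t"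
  shows "fo (\<lambda>e. P (t e) e)"
proof -
  have "fo (\<lambda>e. \<exists>x. x = t e \<and> P x e)"
    by (rule fo_ex) (intro fo_and assms(1) assms(2)[unfolded fot_def])
  then show ?thesis by simp
qed

lemma fo_comp1: "fo (\<lambda>e. R (e 0)) \<Longrightarrow> fot s \<Longrightarrow> fo (\<lambda>e. R (s e))"
  by (rule fo_subst1)

lemma fo_comp2:
  assumes "fo (\<lambda>e. R (e 0) (e 1))" and "fot s" and "fot t"
  shows "fo (\<lambda>e. R (s e) (t e))"
proof (rule fo_subst1[OF _ assms(2)])
  show "fo (\<lambda>e. R (e 0) (t (\<lambda>i. e (Suc i))))"
    by (rule fo_subst1[OF _ fot_rename[OF assms(3)]])
      (use fo_rename[OF assms(1), of "\<lambda>i. 1 - i"] in simp)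
qed

lemma fo_comp3:
  assumes "fo (\<lambda>e. R (e 0) (e 1) (e 2))" and "fot s" and "fot t" and "fot u"
  shows "fo (\<lambda>e. R (s e) (t e) (u e))"
proof (rule fo_subst1[OF _ assms(2)])
  show "fo (\<lambda>e. R (e 0) (t (\<lambda>i. e (Suc i))) (u (\<lambda>i. e (Suc i))))"
  proof (rule fo_subst1[OF _ fot_rename[OF assms(3)]])
    show "fo (\<lambda>e. R (e (Suc 0)) (e 0) (u (\<lambda>i. e (Suc (Suc i)))))"
      by (rule fo_subst1[OF _ fot_rename[OF assms(4)]])
        (use fo_rename[OF assms(1), of "\<lambda>i. 2 - i"] in \<open>simp add: numeral_2_eq_2\<close>)
  qed
qed

lemma fot_comp1:
  assumes "fo (\<lambda>e. e 0 = h (e 1))" and "fot s"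
  shows "fot (\<lambda>e. h (s e))"
  unfolding fot_def
  by (rule fo_comp2[of "\<lambda>x y. x = h y", OF assms(1) fot_var fot_rename[OF assms(2)]])

lemma fot_comp2:
  assumes "fo (\<lambda>e. e 0 = h (e 1) (e 2))" and "fot s" and "fot t"
  shows "fot (\<lambda>e. h (s e) (t e))"
  unfolding fot_def
  by (rule fo_comp3[of "\<lambda>x y z. x = h y z", OF assms(1) fot_var fot_rename[OF assms(2)]
        fot_rename[OF assms(3)]])

lemma fo_mem [fo_rules]: "fot s \<Longrightarrow> fot t \<Longrightarrow> fo (\<lambda>e. s e \<in>\<^sub>V t e)"
  by (rule fo_comp2[of "(\<in>\<^sub>V)"]) (auto intro!: fo_mem0 simp: trm_def)

lemma fo_eq [fo_rules]: "fot s \<Longrightarrow> fot t \<Longrightarrow> fo (\<lambda>e. s e = t e)"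
  by (rule fo_comp2[of "(=)"]) (auto intro!: fo_eq0 simp: trm_def)

lemma mem_Sep_env:
  assumes "fo (\<lambda>e. P (e 0) (\<lambda>i. e (Suc i)))"
  shows "x \<in>\<^sub>V Sep a (\<lambda>x. P x e) \<longleftrightarrow> x \<in>\<^sub>V a \<and> P x e"
  unfolding Sep_def
  using mem_Coll_iff[of "\<lambda>x. x \<in>\<^sub>V a \<and> P x e" x] fo_separation[OF assms, of a e] by simp

lemma mem_Sep: "fo (\<lambda>e. P (e 0)) \<Longrightarrow> x \<in>\<^sub>V Sep a P \<longleftrightarrow> x \<in>\<^sub>V a \<and> P x"
  using mem_Sep_env[of "\<lambda>x e. P x"] by simp

lemma eqI: "(\<And>z. z \<in>\<^sub>V x \<longleftrightarrow> z \<in>\<^sub>V y) \<Longrightarrow> x = (y::'v::zf)"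
  by (rule extensionality) simp

lemma fot_Sep [fo_rules]:
  assumes "fot a" and P: "fo (\<lambda>e. P (e 0) (\<lambda>i. e (Suc i)))"
  shows "fot (\<lambda>e. Sep (a e) (\<lambda>x. P x e))"
proof -
  have "fo (\<lambda>e. \<forall>z. z \<in>\<^sub>V e 0 \<longleftrightarrow> z \<in>\<^sub>V a (\<lambda>i. e (Suc i)) \<and> P z (\<lambda>i. e (Suc i)))"
    by (rule fo_all, intro fo_iff fo_and fo_mem fot_var)
      (use fot_rename[OF assms(1), of "\<lambda>i. Suc (Suc i)"]
        fo_rename[OF P, of "case_nat 0 (\<lambda>i. Suc (Suc i))"] in simp_all)
  moreover have "x = Sep (a e) (\<lambda>x. P x e) \<longleftrightarrow> (\<forall>z. z \<in>\<^sub>V x \<longleftrightarrow> z \<in>\<^sub>V a e \<and> P z e)" for x e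
    using mem_Sep_env[OF P, of _ "a e" e] eqI[of x "Sep (a e) (\<lambda>x. P x e)"] by auto
  ultimately show ?thesis unfolding fot_def by simp
qed

subsection \<open>Sets, functions and ordinals in the model\<close>

lemma mem_upair: "z \<in>\<^sub>V upair x y \<longleftrightarrow> z = x \<or> z = y"
  unfolding upair_def by (rule mem_Coll_iff[OF pairing])

lemma mem_vpow: "z \<in>\<^sub>V vpow x \<longleftrightarrow> z \<subseteq>\<^sub>V x"
  unfolding vpow_def by (rule mem_Coll_iff) (simp add: power_set vsubset_def)

lemma vsubsetI: "(\<And>x. x \<in>\<^sub>V a \<Longrightarrow> x \<in>\<^sub>V b) \<Longrightarrow> a \<subseteq>\<^sub>V b"
  by (simp add: vsubset_def)

lemma vsubsetD: "a \<subseteq>\<^sub>V b \<Longrightarrow> x \<in>\<^sub>V a \<Longrightarrow> x \<in>\<^sub>V b"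
  by (simp add: vsubset_def)

lemma fot_upair [fo_rules]:
  assumes "fot s" "fot t" shows "fot (\<lambda>e. upair (s e) (t e))"
proof (rule fot_comp2[OF _ assms])
  have "x = upair y z \<longleftrightarrow> (\<forall>w. w \<in>\<^sub>V x \<longleftrightarrow> w = y \<or> w = z)" for x y z :: 'a
    using mem_upair[of _ y z] eqI[of x "upair y z"] by auto
  moreover have "fo (\<lambda>e :: nat \<Rightarrow> 'a. \<forall>w. w \<in>\<^sub>V e 0 \<longleftrightarrow> w = e 1 \<or> w = e 2)"
    by (intro fo_rules)
  ultimately show "fo (\<lambda>e :: nat \<Rightarrow> 'a. e 0 = upair (e 1) (e 2))" by simp
qed

lemma fot_opair [fo_rules]: "fot s \<Longrightarrow> fot t \<Longrightarrow> fot (\<lambda>e. opair (s e) (t e))"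
  unfolding opair_def by (intro fo_rules)

lemma fo_vsubset [fo_rules]: "fot s \<Longrightarrow> fot t \<Longrightarrow> fo (\<lambda>e. s e \<subseteq>\<^sub>V t e)"
  by (rule fo_comp2[of "(\<subseteq>\<^sub>V)"]) (unfold vsubset_def, intro fo_rules)

lemma upair_eq_iff: "upair x y = upair u v \<longleftrightarrow> x = u \<and> y = v \<or> x = v \<and> y = u"
proof
  assume "upair x y = upair u v"
  then have "z = x \<or> z = y \<longleftrightarrow> z = u \<or> z = v" for z
    using mem_upair[of z x y] mem_upair[of z u v] by simp
  from this[of x] this[of y] this[of u] this[of v] show "x = u \<and> y = v \<or> x = v \<and> y = u"
    by blast
next
  assume "x = u \<and> y = v \<or> x = v \<and> y = u"
  then show "upair x y = upair u v" by (auto intro!: eqI simp: mem_upair)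
qed

lemma opair_eq_iff: "opair x y = opair u v \<longleftrightarrow> x = u \<and> y = v"
  unfolding opair_def by (auto simp: upair_eq_iff)

lemma fo_is_fun [fo_rules]: "fot r \<Longrightarrow> fot s \<Longrightarrow> fot t \<Longrightarrow> fo (\<lambda>e. is_fun (r e) (s e) (t e))"
  by (rule fo_comp3[of is_fun]) (unfold is_fun_def Ex1_def, intro fo_rules)

lemma app_mem:
  assumes "is_fun f a b" "x \<in>\<^sub>V a" shows "app f x \<in>\<^sub>V b \<and> opair x (app f x) \<in>\<^sub>V f"
proof -
  have "\<exists>!y. opair x y \<in>\<^sub>V f" using assms unfolding is_fun_def by blast
  from theI'[OF this] have *: "opair x (app f x) \<in>\<^sub>V f" unfolding app_def .
  then obtain u v where "v \<in>\<^sub>V b" "opair x (app f x) = opair u v"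
    using assms(1) unfolding is_fun_def by blast
  with * show ?thesis using opair_eq_iff[of x "app f x" u v] by blast
qed

text \<open>\<open>app f x\<close> is a description that means nothing unless \<open>f\<close> is a
  function at \<open>x\<close>, so it has no rule in \<open>fo_rules\<close>. This equivalence
  trades it for membership of a pair, which is definable.\<close>

lemma opair_mem_iff:
  assumes "is_fun f a b" shows "opair x y \<in>\<^sub>V f \<longleftrightarrow> x \<in>\<^sub>V a \<and> y = app f x"
proof
  assume xy: "opair x y \<in>\<^sub>V f"
  then obtain u v where "u \<in>\<^sub>V a" "opair x y = opair u v"
    using assms unfolding is_fun_def by blast
  then have x: "x \<in>\<^sub>V a" by (simp add: opair_eq_iff)
  then have "\<exists>!y. opair x y \<in>\<^sub>V f" using assms unfolding is_fun_def by blast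
  then show "x \<in>\<^sub>V a \<and> y = app f x" using x xy app_mem[OF assms x] by blast
qed (use app_mem[OF assms] in blast)

lemma is_funI:
  assumes "\<And>p. p \<in>\<^sub>V f \<longleftrightarrow> (\<exists>x y. x \<in>\<^sub>V a \<and> R x y \<and> p = opair x y)"
    and "\<And>x. x \<in>\<^sub>V a \<Longrightarrow> \<exists>!y. R x y" and "\<And>x y. x \<in>\<^sub>V a \<Longrightarrow> R x y \<Longrightarrow> y \<in>\<^sub>V b"
  shows "is_fun f a b"
proof -
  have *: "opair x y \<in>\<^sub>V f \<longleftrightarrow> x \<in>\<^sub>V a \<and> R x y" for x y
    using assms(1) by (auto simp: opair_eq_iff)
  show ?thesis
    unfolding is_fun_def * using assms by blast
qed

text \<open>Replacement is applied to the map from x to the pair of x and its value, so it yields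
  the graph directly.\<close>

lemma ex_fun_rel:
  assumes "fo (\<lambda>e. R (e 0) (e 1))" and "\<And>x. x \<in>\<^sub>V a \<Longrightarrow> \<exists>!y. R x y"
    and "\<And>x y. x \<in>\<^sub>V a \<Longrightarrow> R x y \<Longrightarrow> y \<in>\<^sub>V b"
  shows "\<exists>f. is_fun f a b \<and> (\<forall>x y. opair x y \<in>\<^sub>V f \<longleftrightarrow> x \<in>\<^sub>V a \<and> R x y)"
proof -
  have "\<exists>f. \<forall>p. p \<in>\<^sub>V f \<longleftrightarrow> (\<exists>x. x \<in>\<^sub>V a \<and> (\<exists>y. R x y \<and> p = opair x y))"
    by (rule fo_replacement, intro fo_rules fo_comp2[OF assms(1)]) (use assms(2) in blast)
  then obtain f where f: "\<And>p. p \<in>\<^sub>V f \<longleftrightarrow> (\<exists>x. x \<in>\<^sub>V a \<and> (\<exists>y. R x y \<and> p = opair x y))" by blast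
  then have *: "opair x y \<in>\<^sub>V f \<longleftrightarrow> x \<in>\<^sub>V a \<and> R x y" for x y
    by (auto simp: opair_eq_iff)
  then have "is_fun f a b"
    using is_funI[of f a R b] assms(2,3) f by blast
  with * show ?thesis by blast
qed

lemma ex_fun:
  assumes "fo (\<lambda>e. e 0 = t (e 1))" and "\<And>x. x \<in>\<^sub>V a \<Longrightarrow> t x \<in>\<^sub>V b"
  shows "\<exists>f. is_fun f a b \<and> (\<forall>x. x \<in>\<^sub>V a \<longrightarrow> app f x = t x)"
proof -
  have "fo (\<lambda>e. e 1 = t (e 0))"
    using fo_rename[OF assms(1), of "\<lambda>i. 1 - i"] by simp
  then obtain f where "is_fun f a b" "\<And>x y. opair x y \<in>\<^sub>V f \<longleftrightarrow> x \<in>\<^sub>V a \<and> y = t x"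
    using ex_fun_rel[of "\<lambda>x y. y = t x" a b] assms(2) by blast
  then have "is_fun f a b" "app f x = t x" if "x \<in>\<^sub>V a" for x
    using app_mem[of f a b x] that by blast+
  with \<open>is_fun f a b\<close> show ?thesis by blast
qed

lemma is_inj_iff:
  "is_inj f a b \<longleftrightarrow> is_fun f a b \<and> (\<forall>x y z. opair x z \<in>\<^sub>V f \<and> opair y z \<in>\<^sub>V f \<longrightarrow> x = y)"
proof (cases "is_fun f a b")
  case True
  show ?thesis unfolding is_inj_def opair_mem_iff[OF True] by auto
qed (simp add: is_inj_def)

lemma is_bij_iff:
  "is_bij f a b \<longleftrightarrow> is_inj f a b \<and> (\<forall>y. y \<in>\<^sub>V b \<longrightarrow> (\<exists>x. opair x y \<in>\<^sub>V f))"
proof (cases "is_fun f a b")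
  case True
  show ?thesis unfolding is_bij_def opair_mem_iff[OF True] by auto
qed (simp add: is_bij_def is_inj_def)

lemma fo_is_inj [fo_rules]: "fot r \<Longrightarrow> fot s \<Longrightarrow> fot t \<Longrightarrow> fo (\<lambda>e. is_inj (r e) (s e) (t e))"
  by (rule fo_comp3[of is_inj]) (unfold is_inj_iff, intro fo_rules)

lemma fo_is_bij [fo_rules]: "fot r \<Longrightarrow> fot s \<Longrightarrow> fot t \<Longrightarrow> fo (\<lambda>e. is_bij (r e) (s e) (t e))"
  by (rule fo_comp3[of is_bij]) (unfold is_bij_iff, intro fo_rules)

section \<open>Foundation and ordinals\<close>

lemma ex_minimal:
  assumes "fo (\<lambda>e. P (e 0))" and "x \<in>\<^sub>V a" and "P x"
  shows "\<exists>m. m \<in>\<^sub>V a \<and> P m \<and> (\<forall>y. y \<in>\<^sub>V m \<longrightarrow> y \<in>\<^sub>V a \<longrightarrow> \<not> P y)"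
  using foundation[of "Sep a P"] assms(2,3) unfolding mem_Sep[of P, OF assms(1)] by metis

lemma not_mem_self: "\<not> x \<in>\<^sub>V (x::'v::zf)"
  using foundation[of "upair x x"] unfolding mem_upair by blast

lemma fo_Ord [fo_rules]: "fot s \<Longrightarrow> fo (\<lambda>e. Ord (s e))"
  by (rule fo_comp1[of Ord]) (unfold Ord_def nonempty_def, intro fo_rules)

lemma Ord_trans: "Ord \<alpha> \<Longrightarrow> \<beta> \<in>\<^sub>V \<alpha> \<Longrightarrow> \<gamma> \<in>\<^sub>V \<beta> \<Longrightarrow> \<gamma> \<in>\<^sub>V \<alpha>"
  unfolding Ord_def vsubset_def by blast

lemma Ord_mem: assumes "Ord \<alpha>" "\<beta> \<in>\<^sub>V \<alpha>" shows "Ord \<beta>"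
proof -
  have sub: "x \<in>\<^sub>V \<alpha>" if "x \<in>\<^sub>V \<beta>" for x using Ord_trans assms that by blast
  note \<alpha> = assms(1)[unfolded Ord_def, THEN conjunct2, THEN conjunct2]
  note \<alpha>3 = \<alpha>[THEN conjunct1] and \<alpha>45 = \<alpha>[THEN conjunct2]
  have trans: "x \<in>\<^sub>V z" if "x \<in>\<^sub>V y" "y \<in>\<^sub>V z" "z \<in>\<^sub>V \<alpha>" for x y z
    using \<alpha>3 that Ord_trans[OF assms(1)] by blast
  show ?thesis
    unfolding Ord_def
  proof (intro conjI allI impI)
    fix s assume "s \<subseteq>\<^sub>V \<beta> \<and> nonempty s"
    then have "s \<subseteq>\<^sub>V \<alpha> \<and> nonempty s" using sub by (simp add: vsubset_def)
    then show "\<exists>m. m \<in>\<^sub>V s \<and> (\<forall>x. x \<in>\<^sub>V s \<longrightarrow> \<not> x \<in>\<^sub>V m)"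
      using \<alpha>45[THEN conjunct2] by blast
  next
    fix x y assume "x \<in>\<^sub>V \<beta> \<and> y \<in>\<^sub>V \<beta>"
    then show "x \<in>\<^sub>V y \<or> x = y \<or> y \<in>\<^sub>V x"
      using \<alpha>45[THEN conjunct1] sub by blast
  qed (use trans assms sub not_mem_self in \<open>blast intro: vsubsetI\<close>)+
qed

text \<open>A transitive proper subset of an ordinal equals the least element that it
  misses.\<close>

lemma Ord_transitive_subset:
  assumes "Ord \<alpha>" "\<gamma> \<subseteq>\<^sub>V \<alpha>" "\<And>x y. y \<in>\<^sub>V x \<Longrightarrow> x \<in>\<^sub>V \<gamma> \<Longrightarrow> y \<in>\<^sub>V \<gamma>"
  shows "\<gamma> = \<alpha> \<or> \<gamma> \<in>\<^sub>V \<alpha>"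
proof (cases "\<alpha> \<subseteq>\<^sub>V \<gamma>")
  case True
  then show ?thesis using assms(2) by (metis eqI vsubsetD)
next
  case False
  then obtain x where "x \<in>\<^sub>V \<alpha>" "\<not> x \<in>\<^sub>V \<gamma>" by (auto simp: vsubset_def)
  moreover have "fo (\<lambda>e. \<not> e 0 \<in>\<^sub>V \<gamma>)" by (intro fo_rules)
  ultimately obtain m where m: "m \<in>\<^sub>V \<alpha>" "\<not> m \<in>\<^sub>V \<gamma>" "\<And>y. y \<in>\<^sub>V m \<Longrightarrow> y \<in>\<^sub>V \<alpha> \<Longrightarrow> y \<in>\<^sub>V \<gamma>"
    using ex_minimal[of "\<lambda>x. \<not> x \<in>\<^sub>V \<gamma>" x \<alpha>] by blast
  have "\<gamma> = m"
  proof (rule eqI)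
    fix y
    have "y \<in>\<^sub>V m" if "y \<in>\<^sub>V \<gamma>"
      using that assms m unfolding Ord_def vsubset_def by metis
    then show "y \<in>\<^sub>V \<gamma> \<longleftrightarrow> y \<in>\<^sub>V m" using m Ord_trans[OF assms(1)] by blast
  qed
  then show ?thesis using m by simp
qed

text \<open>The intersection of the two ordinals is transitive, and it cannot be a member of both,
  since it would then be a member of itself.\<close>

lemma Ord_linear:
  assumes "Ord \<alpha>" "Ord \<beta>" shows "\<alpha> \<in>\<^sub>V \<beta> \<or> \<alpha> = \<beta> \<or> \<beta> \<in>\<^sub>V \<alpha>"
proof -
  define \<gamma> where "\<gamma> = Sep \<alpha> (\<lambda>x. x \<in>\<^sub>V \<beta>)"
  have mem: "x \<in>\<^sub>V \<gamma> \<longleftrightarrow> x \<in>\<^sub>V \<alpha> \<and> x \<in>\<^sub>V \<beta>" for x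
    unfolding \<gamma>_def by (rule mem_Sep) (intro fo_rules)
  have trans: "\<And>x y. y \<in>\<^sub>V x \<Longrightarrow> x \<in>\<^sub>V \<gamma> \<Longrightarrow> y \<in>\<^sub>V \<gamma>"
    using Ord_trans[OF assms(1)] Ord_trans[OF assms(2)] unfolding mem by blast
  have sub: "\<gamma> \<subseteq>\<^sub>V \<alpha>" "\<gamma> \<subseteq>\<^sub>V \<beta>" by (simp_all add: vsubset_def mem)
  have "\<gamma> = \<alpha> \<or> \<gamma> \<in>\<^sub>V \<alpha>"
    by (rule Ord_transitive_subset[OF assms(1) sub(1)]) (rule trans)
  moreover have "\<gamma> = \<beta> \<or> \<gamma> \<in>\<^sub>V \<beta>"
    by (rule Ord_transitive_subset[OF assms(2) sub(2)]) (rule trans)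
  ultimately show ?thesis using mem[of \<gamma>] not_mem_self[of \<gamma>] by blast
qed

lemma OrdI:
  assumes "\<And>x y. y \<in>\<^sub>V x \<Longrightarrow> x \<in>\<^sub>V \<alpha> \<Longrightarrow> y \<in>\<^sub>V \<alpha>" and "\<And>x. x \<in>\<^sub>V \<alpha> \<Longrightarrow> Ord x"
  shows "Ord \<alpha>"
  unfolding Ord_def
proof (intro conjI allI impI)
  fix s assume "s \<subseteq>\<^sub>V \<alpha> \<and> nonempty s"
  then show "\<exists>m. m \<in>\<^sub>V s \<and> (\<forall>x. x \<in>\<^sub>V s \<longrightarrow> \<not> x \<in>\<^sub>V m)"
    using foundation[of s] unfolding nonempty_def by blast
qed (use assms Ord_linear not_mem_self Ord_trans vsubsetI in \<open>blast+\<close>)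

text \<open>Foundation speaks of sets, so the search is confined to the members of \<alpha>; if none
  satisfies \<open>P\<close>, then \<alpha> itself is least.\<close>

lemma ex_least_Ord:
  assumes "fo (\<lambda>e. P (e 0))" "Ord \<alpha>" "P \<alpha>"
  shows "\<exists>\<beta>. Ord \<beta> \<and> P \<beta> \<and> (\<forall>\<gamma>. \<gamma> \<in>\<^sub>V \<beta> \<longrightarrow> \<not> P \<gamma>)"
proof (cases "\<exists>\<beta>. \<beta> \<in>\<^sub>V \<alpha> \<and> P \<beta>")
  case True
  then obtain m where "m \<in>\<^sub>V \<alpha>" "P m" "\<forall>y. y \<in>\<^sub>V m \<longrightarrow> y \<in>\<^sub>V \<alpha> \<longrightarrow> \<not> P y"
    using ex_minimal[of P, OF assms(1)] by metis
  then show ?thesis using assms(2) Ord_mem Ord_trans by blast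
next
  case False
  then show ?thesis using assms by blast
qed

lemma Ord_induct_fo:
  assumes "fo (\<lambda>e. P (e 0))" "Ord \<alpha>"
    and step: "\<And>\<beta>. Ord \<beta> \<Longrightarrow> (\<And>\<gamma>. \<gamma> \<in>\<^sub>V \<beta> \<Longrightarrow> P \<gamma>) \<Longrightarrow> P \<beta>"
  shows "P \<alpha>"
proof (rule ccontr)
  assume "\<not> P \<alpha>"
  then obtain \<beta> where "Ord \<beta>" "\<not> P \<beta>" "\<forall>\<gamma>. \<gamma> \<in>\<^sub>V \<beta> \<longrightarrow> \<not> \<not> P \<gamma>"
    using ex_least_Ord[of "\<lambda>x. \<not> P x" \<alpha>, OF fo_not] assms(1,2) by metis
  then show False using step by blast
qed

lemma least_ord_works:
  assumes "fo (\<lambda>e. P (e 0))" "Ord \<alpha>" "P \<alpha>"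
  shows "Ord (least_ord P)" "P (least_ord P)" "\<And>\<beta>. \<beta> \<in>\<^sub>V least_ord P \<Longrightarrow> \<not> P \<beta>"
proof -
  have "\<exists>!\<alpha>. Ord \<alpha> \<and> P \<alpha> \<and> (\<forall>\<beta>. \<beta> \<in>\<^sub>V \<alpha> \<longrightarrow> \<not> P \<beta>)"
    using ex_least_Ord[of P, OF assms] Ord_linear by metis
  from theI'[OF this] show "Ord (least_ord P)" "P (least_ord P)"
    "\<And>\<beta>. \<beta> \<in>\<^sub>V least_ord P \<Longrightarrow> \<not> P \<beta>"
    unfolding least_ord_def by blast+
qed

text \<open>Burali-Forti: the ordinals would form an ordinal that belongs to itself.\<close>

lemma no_set_of_ordinals: "\<not> (\<forall>x. Ord x \<longrightarrow> x \<in>\<^sub>V (a::'v::zf))"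
proof
  assume a: "\<forall>x. Ord x \<longrightarrow> x \<in>\<^sub>V a"
  have mem: "x \<in>\<^sub>V Sep a Ord \<longleftrightarrow> Ord x" for x
    using mem_Sep[of Ord x a, OF fo_Ord[OF fot_var]] a by blast
  then have "Ord (Sep a Ord)" using Ord_mem by (blast intro: OrdI)
  then show False using mem not_mem_self by blast
qed

subsection \<open>Hartogs numbers and order types\<close>

text \<open>An injection \<open>f\<close> from an ordinal \<open>\<alpha>\<close> into \<open>Z\<close> is coded by the chain of its initial images,
  a member of \<open>vpow (vpow Z)\<close> that determines \<open>\<alpha>\<close>.\<close>

definition init_image :: "'v::zf \<Rightarrow> 'v \<Rightarrow> 'v \<Rightarrow> 'v" where
  "init_image Z f x = Sep Z (\<lambda>z. \<exists>w. w \<in>\<^sub>V x \<and> opair w z \<in>\<^sub>V f)"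

lemma mem_init_image: "z \<in>\<^sub>V init_image Z f x \<longleftrightarrow> z \<in>\<^sub>V Z \<and> (\<exists>w. w \<in>\<^sub>V x \<and> opair w z \<in>\<^sub>V f)"
  unfolding init_image_def by (rule mem_Sep) (intro fo_rules)

lemma fot_init_image [fo_rules]:
  assumes "fot f" "fot x" shows "fot (\<lambda>e. init_image Z (f e) (x e))"
proof (rule fot_comp2[OF _ assms])
  have "fot (\<lambda>e. init_image Z (e 0) (e 1))"
    unfolding init_image_def by (intro fo_rules)
  then show "fo (\<lambda>e. e 0 = init_image Z (e 1) (e 2))" by (simp add: fot_def numeral_2_eq_2)
qed

lemma init_image_subset_iff:
  assumes "Ord \<alpha>" "is_inj f \<alpha> Z" "x \<in>\<^sub>V \<alpha>" "y \<in>\<^sub>V \<alpha>"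
  shows "init_image Z f x \<subseteq>\<^sub>V init_image Z f y \<longleftrightarrow> x \<in>\<^sub>V y \<or> x = y"
proof
  assume sub: "init_image Z f x \<subseteq>\<^sub>V init_image Z f y"
  have "\<not> y \<in>\<^sub>V x"
  proof
    assume "y \<in>\<^sub>V x"
    then have "app f y \<in>\<^sub>V init_image Z f x"
      using assms unfolding mem_init_image is_inj_def by (blast dest: app_mem)
    then have "app f y \<in>\<^sub>V init_image Z f y" using sub by (simp add: vsubset_def)
    then obtain w where "w \<in>\<^sub>V y" "opair w (app f y) \<in>\<^sub>V f" unfolding mem_init_image by blast
    moreover have "opair y (app f y) \<in>\<^sub>V f" using assms unfolding is_inj_def by (blast dest: app_mem)
    ultimately have "y \<in>\<^sub>V y" using assms(2) unfolding is_inj_iff by metis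
    then show False using not_mem_self by blast
  qed
  then show "x \<in>\<^sub>V y \<or> x = y" using Ord_linear[of x y] assms Ord_mem by blast
next
  assume "x \<in>\<^sub>V y \<or> x = y"
  then show "init_image Z f x \<subseteq>\<^sub>V init_image Z f y"
    using Ord_trans[OF Ord_mem[OF assms(1,4)]] by (auto simp: vsubset_def mem_init_image)
qed

text \<open>Under inclusion the initial images form a chain ordered like the ordinal. Two injections
  with the same chain thus induce an order isomorphism between their ordinals, and induction shows
  that it fixes every point.\<close>

lemma init_images_determine_subset:
  assumes "Ord \<alpha>" "is_inj f \<alpha> Z" "Ord \<beta>" "is_inj g \<beta> Z"
    and eq: "\<And>c. (\<exists>x. x \<in>\<^sub>V \<alpha> \<and> c = init_image Z f x) \<longleftrightarrow> (\<exists>x. x \<in>\<^sub>V \<beta> \<and> c = init_image Z g x)"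
  shows "\<alpha> \<subseteq>\<^sub>V \<beta>"
proof (rule vsubsetI)
  have *: "x \<in>\<^sub>V \<alpha> \<longrightarrow> (\<forall>y. y \<in>\<^sub>V \<beta> \<longrightarrow> init_image Z f x = init_image Z g y \<longrightarrow> x = y)"
    if "Ord x" for x
  proof (rule Ord_induct_fo[OF _ that], intro fo_rules, intro impI allI)
    fix x y assume IH: "\<And>z. z \<in>\<^sub>V x \<Longrightarrow> z \<in>\<^sub>V \<alpha> \<longrightarrow> (\<forall>y. y \<in>\<^sub>V \<beta> \<longrightarrow> init_image Z f z = init_image Z g y \<longrightarrow> z = y)"
      and x: "x \<in>\<^sub>V \<alpha>" and y: "y \<in>\<^sub>V \<beta>" and xy: "init_image Z f x = init_image Z g y"
    show "x = y"
    proof (rule eqI, rule iffI)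
      fix z assume z: "z \<in>\<^sub>V x"
      then have za: "z \<in>\<^sub>V \<alpha>" using x assms(1) Ord_trans by blast
      then obtain w where w: "w \<in>\<^sub>V \<beta>" "init_image Z f z = init_image Z g w" using eq by blast
      then have "z = w" using IH z za by blast
      moreover have "init_image Z g w \<subseteq>\<^sub>V init_image Z g y" "\<not> init_image Z g y \<subseteq>\<^sub>V init_image Z g w"
        using init_image_subset_iff[OF assms(1,2)] x za z xy w Ord_mem[OF assms(1)]
          Ord_trans[OF Ord_mem[OF assms(1) za]] not_mem_self by metis+
      ultimately show "z \<in>\<^sub>V y"
        using init_image_subset_iff[OF assms(3,4)] w y by metis
    next
      fix w assume w: "w \<in>\<^sub>V y"
      then have wb: "w \<in>\<^sub>V \<beta>" using y assms(3) Ord_trans by blast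
      then obtain z where z: "z \<in>\<^sub>V \<alpha>" "init_image Z f z = init_image Z g w" using eq by metis
      have "init_image Z g w \<subseteq>\<^sub>V init_image Z g y" "\<not> init_image Z g y \<subseteq>\<^sub>V init_image Z g w"
        using init_image_subset_iff[OF assms(3,4)] y wb w
          Ord_trans[OF Ord_mem[OF assms(3) wb]] not_mem_self by metis+
      then have "z \<in>\<^sub>V x"
        using init_image_subset_iff[OF assms(1,2)] z x xy by metis
      then show "w \<in>\<^sub>V x" using IH z wb by metis
    qed
  qed
  fix x assume x: "x \<in>\<^sub>V \<alpha>"
  then obtain y where "y \<in>\<^sub>V \<beta>" "init_image Z f x = init_image Z g y" using eq by blast
  then show "x \<in>\<^sub>V \<beta>" using * x Ord_mem[OF assms(1)] by metis
qed

text \<open>If every ordinal injected into \<open>Z\<close>, Replacement applied to the map from a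
  chain in \<open>vpow (vpow Z)\<close> to its ordinal would collect all ordinals in a set.\<close>

lemma ex_Ord_not_inj: "\<exists>\<alpha>. Ord \<alpha> \<and> \<not> (\<exists>f. is_inj f \<alpha> Z)"
proof (rule ccontr)
  assume contra: "\<not> ?thesis"
  define R where "R C \<alpha> \<longleftrightarrow> Ord \<alpha> \<and> (\<exists>f. is_inj f \<alpha> Z \<and>
    (\<forall>c. c \<in>\<^sub>V C \<longleftrightarrow> (\<exists>x. x \<in>\<^sub>V \<alpha> \<and> c = init_image Z f x)))" for C \<alpha>
  have R_unique: "\<alpha> = \<beta>" if "R C \<alpha>" "R C \<beta>" for C \<alpha> \<beta>
  proof -
    have "\<alpha> \<subseteq>\<^sub>V \<beta>" if "R C \<alpha>" "R C \<beta>" for \<alpha> \<beta>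
      using that init_images_determine_subset[of \<alpha> _ Z \<beta>] unfolding R_def by metis
    then show ?thesis using that by (metis eqI vsubsetD)
  qed
  have "fo (\<lambda>e. R (e 0) (e 1))" unfolding R_def by (intro fo_rules)
  then obtain b where b: "\<And>\<alpha>. \<alpha> \<in>\<^sub>V b \<longleftrightarrow> (\<exists>C. C \<in>\<^sub>V vpow (vpow Z) \<and> R C \<alpha>)"
    using fo_replacement[of R "vpow (vpow Z)"] R_unique by blast
  have "\<alpha> \<in>\<^sub>V b" if \<alpha>: "Ord \<alpha>" for \<alpha>
  proof -
    obtain f where f: "is_inj f \<alpha> Z" using contra \<alpha> by blast
    define C where "C = Sep (vpow Z) (\<lambda>c. \<exists>x. x \<in>\<^sub>V \<alpha> \<and> c = init_image Z f x)"
    have C: "c \<in>\<^sub>V C \<longleftrightarrow> c \<in>\<^sub>V vpow Z \<and> (\<exists>x. x \<in>\<^sub>V \<alpha> \<and> c = init_image Z f x)" for c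
      unfolding C_def by (rule mem_Sep) (intro fo_rules)
    moreover have "init_image Z f x \<in>\<^sub>V vpow Z" for x
      by (simp add: mem_vpow vsubset_def mem_init_image)
    ultimately have "R C \<alpha>" "C \<in>\<^sub>V vpow (vpow Z)"
      unfolding R_def mem_vpow[of C] vsubset_def using \<alpha> f by blast+
    then show ?thesis using b by blast
  qed
  then show False using no_set_of_ordinals by blast
qed

lemma hartogs_works:
  shows "Ord (hartogs Z)" "\<not> is_inj f (hartogs Z) Z"
    "\<And>\<beta>. \<beta> \<in>\<^sub>V hartogs Z \<Longrightarrow> \<exists>f. is_inj f \<beta> Z"
proof -
  obtain \<alpha> where "Ord \<alpha>" "\<not> (\<exists>f. is_inj f \<alpha> Z)" using ex_Ord_not_inj by blast
  moreover have "fo (\<lambda>e. \<not> (\<exists>f. is_inj f (e 0) Z))" by (intro fo_rules)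
  ultimately show "Ord (hartogs Z)" "\<not> is_inj f (hartogs Z) Z"
    "\<And>\<beta>. \<beta> \<in>\<^sub>V hartogs Z \<Longrightarrow> \<exists>f. is_inj f \<beta> Z"
    unfolding hartogs_def using least_ord_works[of "\<lambda>\<alpha>. \<not> (\<exists>f. is_inj f \<alpha> Z)" \<alpha>] by blast+
qed

lemma fun_rel_inj:
  assumes "fo (\<lambda>e. R (e 0) (e 1))" and "\<And>x. x \<in>\<^sub>V a \<Longrightarrow> \<exists>y. y \<in>\<^sub>V b \<and> R x y"
    and "\<And>x y z. x \<in>\<^sub>V a \<Longrightarrow> R x y \<Longrightarrow> R x z \<Longrightarrow> y = z"
    and "\<And>x y z. x \<in>\<^sub>V a \<Longrightarrow> y \<in>\<^sub>V a \<Longrightarrow> R x z \<Longrightarrow> R y z \<Longrightarrow> x = y"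
  shows "\<exists>f. is_inj f a b \<and> (\<forall>x y. opair x y \<in>\<^sub>V f \<longleftrightarrow> x \<in>\<^sub>V a \<and> R x y)"
proof -
  have "\<exists>!y. R x y" "\<And>y. R x y \<Longrightarrow> y \<in>\<^sub>V b" if "x \<in>\<^sub>V a" for x using assms(2,3) that by metis+
  then obtain f where "is_fun f a b" "\<forall>x y. opair x y \<in>\<^sub>V f \<longleftrightarrow> x \<in>\<^sub>V a \<and> R x y"
    using ex_fun_rel[of R a b] assms(1) by blast
  then show ?thesis unfolding is_inj_iff using assms(4) by blast
qed

lemma is_inj_subset:
  assumes "is_inj f a b" "c \<subseteq>\<^sub>V a" shows "\<exists>g. is_inj g c b"
proof -
  have f: "is_fun f a b" "\<And>x y z. opair x z \<in>\<^sub>V f \<Longrightarrow> opair y z \<in>\<^sub>V f \<Longrightarrow> x = y"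
    using assms(1) unfolding is_inj_iff by blast+
  have "\<exists>g. is_inj g c b \<and> (\<forall>x y. opair x y \<in>\<^sub>V g \<longleftrightarrow> x \<in>\<^sub>V c \<and> opair x y \<in>\<^sub>V f)"
  proof (rule fun_rel_inj)
    show "\<exists>y. y \<in>\<^sub>V b \<and> opair x y \<in>\<^sub>V f" if "x \<in>\<^sub>V c" for x
      using app_mem[OF f(1) vsubsetD[OF assms(2) that]] by blast
    show "y = z" if "opair x y \<in>\<^sub>V f" "opair x z \<in>\<^sub>V f" for x y z
      using that unfolding opair_mem_iff[OF f(1)] by blast
  qed (intro fo_rules, rule f(2))
  then show ?thesis by blast
qed

lemma mem_hartogs:
  assumes "Ord \<alpha>" "is_inj f \<alpha> Z" shows "\<alpha> \<in>\<^sub>V hartogs Z"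
proof (rule ccontr)
  assume "\<not> \<alpha> \<in>\<^sub>V hartogs Z"
  then have "hartogs Z \<subseteq>\<^sub>V \<alpha>"
    using Ord_linear[OF assms(1) hartogs_works(1)] Ord_trans[OF assms(1)] vsubsetI by metis
  then show False using is_inj_subset[OF assms(2)] hartogs_works(2) by blast
qed

text \<open>A bijection from a smaller \<beta>, read backwards and followed by an injection of
  \<beta> into \<kappa>, would inject the Hartogs number into \<kappa>.\<close>

lemma Card_hartogs:
  assumes "Ord \<kappa>" shows "Card (hartogs \<kappa>)"
  unfolding Card_def
proof (intro conjI allI impI hartogs_works(1) notI)
  fix \<beta> assume "\<beta> \<in>\<^sub>V hartogs \<kappa>" and "\<exists>f. is_bij f \<beta> (hartogs \<kappa>)"
  then obtain f g where f: "is_inj f \<beta> \<kappa>" and g: "is_bij g \<beta> (hartogs \<kappa>)"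
    using hartogs_works(3) by blast
  have fg: "is_fun f \<beta> \<kappa>" "is_fun g \<beta> (hartogs \<kappa>)"
    using f g unfolding is_bij_def is_inj_def by blast+
  have "\<exists>h. is_inj h (hartogs \<kappa>) \<kappa> \<and> (\<forall>x y. opair x y \<in>\<^sub>V h \<longleftrightarrow>
    x \<in>\<^sub>V hartogs \<kappa> \<and> (\<exists>w. opair w x \<in>\<^sub>V g \<and> opair w y \<in>\<^sub>V f))"
  proof (rule fun_rel_inj)
    show "\<exists>y. y \<in>\<^sub>V \<kappa> \<and> (\<exists>w. opair w x \<in>\<^sub>V g \<and> opair w y \<in>\<^sub>V f)" if "x \<in>\<^sub>V hartogs \<kappa>" for x
      using that g app_mem[OF fg(1)] unfolding is_bij_iff opair_mem_iff[OF fg(2)] by blast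
    show "y = z" if "\<exists>w. opair w x \<in>\<^sub>V g \<and> opair w y \<in>\<^sub>V f" "\<exists>w. opair w x \<in>\<^sub>V g \<and> opair w z \<in>\<^sub>V f"
      for x y z
      using that g unfolding is_bij_iff is_inj_iff opair_mem_iff[OF fg(1)] by blast
    show "x = y" if "\<exists>w. opair w x \<in>\<^sub>V g \<and> opair w z \<in>\<^sub>V f" "\<exists>w. opair w y \<in>\<^sub>V g \<and> opair w z \<in>\<^sub>V f"
      for x y z
      using that f unfolding is_inj_iff opair_mem_iff[OF fg(2)] by blast
  qed (intro fo_rules)
  then have "\<exists>h. is_inj h (hartogs \<kappa>) \<kappa>" by blast
  then show False using hartogs_works(2) by blast
qed

text \<open>\<open>card_succ\<close> describes a least ordinal; the Hartogs number of \<kappa> is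
  the cardinal above \<kappa> that makes the description meaningful.\<close>

lemma mem_card_succ:
  assumes "Ord \<kappa>" shows "\<kappa> \<in>\<^sub>V card_succ \<kappa>"
proof -
  have "fo (\<lambda>e :: nat \<Rightarrow> 'a. e 0 = e 1)" by (intro fo_rules)
  then have "\<exists>f. is_inj f \<kappa> \<kappa>" using fun_rel_inj[of "(=)" \<kappa> \<kappa>] by blast
  then have "\<kappa> \<in>\<^sub>V hartogs \<kappa>" using mem_hartogs[OF assms] by blast
  moreover have "fo (\<lambda>e. Card (e 0) \<and> \<kappa> \<in>\<^sub>V e 0)"
    unfolding Card_def by (intro fo_rules)
  ultimately show ?thesis
    unfolding card_succ_def
    using least_ord_works(2)[of "\<lambda>\<mu>. Card \<mu> \<and> \<kappa> \<in>\<^sub>V \<mu>" "hartogs \<kappa>"] Card_hartogs[OF assms]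
      hartogs_works(1) by blast
qed

section \<open>Increasing enumerations of sets of ordinals\<close>

text \<open>For a set \<open>D\<close> of ordinals this is the inverse of its transitive collapse.
  It is written with pairs instead of \<open>app\<close> to be definable.\<close>

definition enum :: "'v::zf \<Rightarrow> 'v \<Rightarrow> 'v \<Rightarrow> bool" where
  "enum f \<alpha> D \<longleftrightarrow> Ord \<alpha> \<and> is_fun f \<alpha> D \<and> (\<forall>y. y \<in>\<^sub>V D \<longrightarrow> (\<exists>x. opair x y \<in>\<^sub>V f)) \<and>
    (\<forall>i j x y. opair i x \<in>\<^sub>V f \<and> opair j y \<in>\<^sub>V f \<and> i \<in>\<^sub>V j \<longrightarrow> x \<in>\<^sub>V y)"

lemma fo_enum [fo_rules]: "fot r \<Longrightarrow> fot s \<Longrightarrow> fot t \<Longrightarrow> fo (\<lambda>e. enum (r e) (s e) (t e))"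
  by (rule fo_comp3[of enum]) (unfold enum_def, intro fo_rules)

lemma enum_iff:
  "enum f \<alpha> D \<longleftrightarrow> Ord \<alpha> \<and> is_fun f \<alpha> D \<and> (\<forall>y. y \<in>\<^sub>V D \<longrightarrow> (\<exists>x. x \<in>\<^sub>V \<alpha> \<and> y = app f x)) \<and>
    (\<forall>i j. i \<in>\<^sub>V \<alpha> \<and> j \<in>\<^sub>V \<alpha> \<and> i \<in>\<^sub>V j \<longrightarrow> app f i \<in>\<^sub>V app f j)"
proof (cases "is_fun f \<alpha> D")
  case True
  show ?thesis unfolding enum_def opair_mem_iff[OF True] by blast
qed (simp add: enum_def)

lemma enum_is_inj:
  assumes "enum f \<alpha> D" shows "is_inj f \<alpha> D"
proof -
  have e: "Ord \<alpha>" "is_fun f \<alpha> D" "\<And>i j. i \<in>\<^sub>V \<alpha> \<Longrightarrow> j \<in>\<^sub>V \<alpha> \<Longrightarrow> i \<in>\<^sub>V j \<Longrightarrow> app f i \<in>\<^sub>V app f j"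
    using assms unfolding enum_iff by blast+
  have "i = j" if "i \<in>\<^sub>V \<alpha>" "j \<in>\<^sub>V \<alpha>" "app f i = app f j" for i j
    using Ord_linear[of i j] Ord_mem[OF e(1)] e(3)[of i j] e(3)[of j i] that not_mem_self by metis
  then show ?thesis unfolding is_inj_def using e(2) by blast
qed

text \<open>In either enumeration the i-th value must be the least element of \<open>D\<close> not
  listed before.\<close>

lemma enum_agree:
  assumes f: "enum f \<alpha> D" and g: "enum g \<beta> D" and D: "\<And>x. x \<in>\<^sub>V D \<Longrightarrow> Ord x"
    and "Ord i"
  shows "i \<in>\<^sub>V \<alpha> \<longrightarrow> i \<in>\<^sub>V \<beta> \<and> (\<forall>x. opair i x \<in>\<^sub>V f \<longrightarrow> opair i x \<in>\<^sub>V g)"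
proof (rule Ord_induct_fo[OF _ assms(4)], intro fo_rules, intro impI)
  fix i assume i: "i \<in>\<^sub>V \<alpha>" "Ord i"
    and IH: "\<And>j. j \<in>\<^sub>V i \<Longrightarrow> j \<in>\<^sub>V \<alpha> \<longrightarrow> j \<in>\<^sub>V \<beta> \<and> (\<forall>x. opair j x \<in>\<^sub>V f \<longrightarrow> opair j x \<in>\<^sub>V g)"
  note f' = f[unfolded enum_iff] and g' = g[unfolded enum_iff]
  have fn: "is_fun f \<alpha> D" "is_fun g \<beta> D" using f' g' by blast+
  have ord: "Ord \<alpha>" "Ord \<beta>" using f' g' by blast+
  have eq: "j \<in>\<^sub>V \<alpha> \<and> j \<in>\<^sub>V \<beta> \<and> app f j = app g j" if "j \<in>\<^sub>V i" for j
    using IH[OF that] Ord_trans[OF ord(1) i(1) that] app_mem[OF fn(1)] opair_mem_iff[OF fn(2)] by blast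
  have fi: "app f i \<in>\<^sub>V D" using app_mem[OF fn(1) i(1)] by blast
  \<comment> \<open>\<open>g\<close> lists \<open>app f i\<close> at j, and \<open>f\<close> will
    list \<open>app g i\<close> at k. Neither place precedes i, because the earlier values agree and
    are smaller. If both came after i, the two i-th values would be members of each other.\<close>
  then obtain j where j: "j \<in>\<^sub>V \<beta>" "app f i = app g j" using g' by blast
  have nj: "\<not> j \<in>\<^sub>V i"
  proof
    assume "j \<in>\<^sub>V i"
    then have "app f j = app f i" and "app f j \<in>\<^sub>V app f i" using eq[of j] j(2) f' i(1) by metis+
    then show False by (simp add: not_mem_self)
  qed
  then have ij: "i = j \<or> i \<in>\<^sub>V j" using Ord_linear[OF i(2) Ord_mem[OF ord(2) j(1)]] by blast
  then have ib: "i \<in>\<^sub>V \<beta>" using j(1) Ord_trans[OF ord(2)] by blast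
  have "app g i \<in>\<^sub>V D" using app_mem[OF fn(2) ib] by blast
  then obtain k where k: "k \<in>\<^sub>V \<alpha>" "app g i = app f k" using f' by blast
  have "\<not> k \<in>\<^sub>V i"
  proof
    assume "k \<in>\<^sub>V i"
    then have "app g k = app g i" and "app g k \<in>\<^sub>V app g i" using eq[of k] k(2) g' ib by metis+
    then show False by (simp add: not_mem_self)
  qed
  then have ik: "i = k \<or> i \<in>\<^sub>V k" using Ord_linear[OF i(2) Ord_mem[OF ord(1) k(1)]] by blast
  have "app f i = app g i"
  proof (cases "i = j \<or> i = k")
    case True
    then show ?thesis using j k by auto
  next
    case False
    then have "app g i \<in>\<^sub>V app g j" "app f i \<in>\<^sub>V app f k" using ij ik f' g' i ib j k by blast+
    then have "app g i \<in>\<^sub>V app f i" "app f i \<in>\<^sub>V app g i" using j k by simp_all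
    then show ?thesis using Ord_trans[OF D[OF fi]] not_mem_self by blast
  qed
  then show "i \<in>\<^sub>V \<beta> \<and> (\<forall>x. opair i x \<in>\<^sub>V f \<longrightarrow> opair i x \<in>\<^sub>V g)"
    using ib unfolding opair_mem_iff[OF fn(1)] opair_mem_iff[OF fn(2)] by simp
qed

lemma enum_unique:
  assumes "enum f \<alpha> D" "enum g \<beta> D" "\<And>x. x \<in>\<^sub>V D \<Longrightarrow> Ord x"
  shows "\<alpha> = \<beta>" "opair i x \<in>\<^sub>V f \<Longrightarrow> opair i x \<in>\<^sub>V g"
proof -
  have ord: "Ord \<alpha>" "Ord \<beta>" and f: "is_fun f \<alpha> D" using assms unfolding enum_iff by blast+
  show "\<alpha> = \<beta>"
    by (rule eqI) (use enum_agree[OF assms(1,2,3)] enum_agree[OF assms(2,1,3)] Ord_mem ord in blast)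
  show "opair i x \<in>\<^sub>V g" if ix: "opair i x \<in>\<^sub>V f"
  proof -
    have "i \<in>\<^sub>V \<alpha>" using ix unfolding opair_mem_iff[OF f] by blast
    then show ?thesis using ix enum_agree[OF assms(1,2,3)] Ord_mem[OF ord(1)] by blast
  qed
qed

text \<open>This is also the intersection of \<open>D\<close> and \<open>y\<close>, so
  \<open>mem_below\<close> serves for intersections of members of filters as well.\<close>

abbreviation (input) below :: "'v::zf \<Rightarrow> 'v \<Rightarrow> 'v" where
  "below D y \<equiv> Sep D (\<lambda>z. z \<in>\<^sub>V y)"

lemma mem_below: "z \<in>\<^sub>V below D y \<longleftrightarrow> z \<in>\<^sub>V D \<and> z \<in>\<^sub>V y"
  by (rule mem_Sep) (intro fo_rules)

lemma enum_restrict: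
  assumes "enum f \<alpha> D" "\<And>x. x \<in>\<^sub>V D \<Longrightarrow> Ord x" "\<beta> \<in>\<^sub>V \<alpha>"
  shows "\<exists>g. enum g \<beta> (below D (app f \<beta>))"
proof -
  have f: "Ord \<alpha>" "is_fun f \<alpha> D" "\<And>y. y \<in>\<^sub>V D \<Longrightarrow> \<exists>x. x \<in>\<^sub>V \<alpha> \<and> y = app f x"
    "\<And>i j. i \<in>\<^sub>V \<alpha> \<Longrightarrow> j \<in>\<^sub>V \<alpha> \<Longrightarrow> i \<in>\<^sub>V j \<Longrightarrow> app f i \<in>\<^sub>V app f j"
    using assms(1) unfolding enum_iff by blast+
  have sub: "\<And>i. i \<in>\<^sub>V \<beta> \<Longrightarrow> i \<in>\<^sub>V \<alpha>" using Ord_trans[OF f(1) assms(3)] .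
  have "\<exists>g. is_fun g \<beta> (below D (app f \<beta>)) \<and> (\<forall>x y. opair x y \<in>\<^sub>V g \<longleftrightarrow> x \<in>\<^sub>V \<beta> \<and> opair x y \<in>\<^sub>V f)"
  proof (rule ex_fun_rel)
    show "\<exists>!y. opair x y \<in>\<^sub>V f" if "x \<in>\<^sub>V \<beta>" for x
      using sub[OF that] unfolding opair_mem_iff[OF f(2)] by blast
    show "y \<in>\<^sub>V below D (app f \<beta>)" if "x \<in>\<^sub>V \<beta>" "opair x y \<in>\<^sub>V f" for x y
      using that(2) f(4)[OF sub[OF that(1)] assms(3) that(1)] app_mem[OF f(2) sub[OF that(1)]]
      unfolding opair_mem_iff[OF f(2)] mem_below by blast
  qed (intro fo_rules)
  then obtain g where g: "is_fun g \<beta> (below D (app f \<beta>))"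
    "\<And>x y. opair x y \<in>\<^sub>V g \<longleftrightarrow> x \<in>\<^sub>V \<beta> \<and> opair x y \<in>\<^sub>V f" by blast
  have "\<exists>i. opair i z \<in>\<^sub>V g" if "z \<in>\<^sub>V below D (app f \<beta>)" for z
  proof -
    have z: "z \<in>\<^sub>V D" "z \<in>\<^sub>V app f \<beta>" using that unfolding mem_below by blast+
    then obtain j where j: "j \<in>\<^sub>V \<alpha>" "z = app f j" using f(3) by blast
    have "Ord z" using assms(2) z(1) by blast
    then have "\<not> app f \<beta> \<in>\<^sub>V z" using Ord_trans[of z "app f \<beta>" z] z not_mem_self by blast
    then have "\<not> \<beta> \<in>\<^sub>V j" using f(4) j assms(3) by blast
    moreover have "j \<noteq> \<beta>" using z j not_mem_self by blast
    ultimately have "j \<in>\<^sub>V \<beta>" using Ord_linear Ord_mem[OF f(1)] j assms(3) by blast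
    then show ?thesis unfolding g(2) opair_mem_iff[OF f(2)] using j by blast
  qed
  moreover have "x \<in>\<^sub>V y" if "opair i x \<in>\<^sub>V g" "opair j y \<in>\<^sub>V g" "i \<in>\<^sub>V j" for i j x y
    using that f(4) unfolding g(2) opair_mem_iff[OF f(2)] by blast
  ultimately have "enum g \<beta> (below D (app f \<beta>))"
    unfolding enum_def using g(1) Ord_mem[OF f(1) assms(3)] by blast
  then show ?thesis by blast
qed

text \<open>\<open>R y \<alpha>\<close> says that the predecessors of y in \<open>D\<close> have
  order type \<alpha>. The types form a set by Replacement, and it is closed downwards, hence an
  ordinal; inverting the map from y to its type enumerates \<open>D\<close>.\<close>

lemma ex_enum_step:
  assumes D: "\<And>x. x \<in>\<^sub>V D \<Longrightarrow> Ord x" and IH: "\<And>y. y \<in>\<^sub>V D \<Longrightarrow> \<exists>\<alpha> f. enum f \<alpha> (below D y)"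
  shows "\<exists>\<alpha> f. enum f \<alpha> D"
proof -
  define R where "R y \<alpha> \<longleftrightarrow> (\<exists>f. enum f \<alpha> (below D y))" for y \<alpha>
  have R_Ord: "Ord \<alpha>" if "R y \<alpha>" for y \<alpha> using that unfolding R_def enum_def by blast
  have R_unique: "\<alpha> = \<beta>" if "R y \<alpha>" "R y \<beta>" for y \<alpha> \<beta>
    using that enum_unique(1)[of _ \<alpha> "below D y"] D unfolding R_def mem_below by blast
  have below2: "below (below D y) x = below D x" if "y \<in>\<^sub>V D" "x \<in>\<^sub>V y" for x y
    by (rule eqI) (use that Ord_trans[OF D] in \<open>auto simp: mem_below\<close>)
  have down: "\<exists>x. x \<in>\<^sub>V D \<and> x \<in>\<^sub>V y \<and> R x \<beta>" if y: "y \<in>\<^sub>V D" and \<alpha>: "R y \<alpha>" "\<beta> \<in>\<^sub>V \<alpha>" for y \<alpha> \<beta>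
  proof -
    obtain f where f: "enum f \<alpha> (below D y)" using \<alpha> unfolding R_def by blast
    then have "app f \<beta> \<in>\<^sub>V below D y" using app_mem \<alpha>(2) unfolding enum_def by blast
    moreover have "\<exists>g. enum g \<beta> (below (below D y) (app f \<beta>))"
      using enum_restrict[OF f _ \<alpha>(2)] D unfolding mem_below by blast
    ultimately show ?thesis using below2[OF y] unfolding R_def mem_below by auto
  qed
  have R_mono: "\<exists>\<beta>. \<beta> \<in>\<^sub>V \<alpha> \<and> R x \<beta>" if y: "y \<in>\<^sub>V D" "x \<in>\<^sub>V D" "x \<in>\<^sub>V y" and \<alpha>: "R y \<alpha>" for x y \<alpha>
  proof -
    obtain f where f: "enum f \<alpha> (below D y)" using \<alpha> unfolding R_def by blast
    have "x \<in>\<^sub>V below D y" using y unfolding mem_below by blast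
    then obtain \<beta> where \<beta>: "\<beta> \<in>\<^sub>V \<alpha>" "x = app f \<beta>" using f unfolding enum_iff by blast
    have "\<exists>g. enum g \<beta> (below (below D y) x)"
      unfolding \<beta>(2) using enum_restrict[OF f _ \<beta>(1)] D unfolding mem_below by blast
    then show ?thesis using \<beta>(1) unfolding R_def below2[OF y(1,3)] by blast
  qed
  have foR: "fo (\<lambda>e. R (e 0) (e 1))" "fo (\<lambda>e. R (e 1) (e 0))" unfolding R_def by (intro fo_rules)+
  obtain a where a: "\<And>\<alpha>. \<alpha> \<in>\<^sub>V a \<longleftrightarrow> (\<exists>y. y \<in>\<^sub>V D \<and> R y \<alpha>)"
    using fo_replacement[of R D, OF foR(1)] R_unique by blast
  have "Ord a"
  proof (rule OrdI)
    show "y \<in>\<^sub>V a" if "y \<in>\<^sub>V x" "x \<in>\<^sub>V a" for x y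
      using that down unfolding a by blast
    show "Ord x" if "x \<in>\<^sub>V a" for x using that R_Ord unfolding a by blast
  qed
  have order: "x \<in>\<^sub>V y" if xy: "x \<in>\<^sub>V D" "y \<in>\<^sub>V D" "R x i" "R y j" "i \<in>\<^sub>V j" for x y i j
  proof -
    have "x \<noteq> y" using xy R_unique not_mem_self by blast
    moreover have "\<not> y \<in>\<^sub>V x"
    proof
      assume "y \<in>\<^sub>V x"
      then obtain \<beta> where "\<beta> \<in>\<^sub>V i" "R y \<beta>" using R_mono[OF xy(1,2) _ xy(3)] by blast
      then have "j \<in>\<^sub>V i" using R_unique xy(4) by blast
      then show False using xy(5) Ord_trans[OF R_Ord[OF xy(3)]] not_mem_self by blast
    qed
    ultimately show ?thesis using Ord_linear[OF D[OF xy(1)] D[OF xy(2)]] by blast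
  qed
  have inj: "x = y" if "x \<in>\<^sub>V D" "y \<in>\<^sub>V D" "R x i" "R y i" for x y i
    using Ord_linear[OF D[OF that(1)] D[OF that(2)]] R_mono[OF that(1,2) _ that(3)]
      R_mono[OF that(2,1) _ that(4)] R_unique that not_mem_self by blast
  have "\<exists>f. is_fun f a D \<and> (\<forall>i y. opair i y \<in>\<^sub>V f \<longleftrightarrow> i \<in>\<^sub>V a \<and> y \<in>\<^sub>V D \<and> R y i)"
  proof (rule ex_fun_rel)
    show "fo (\<lambda>e. e 1 \<in>\<^sub>V D \<and> R (e 1) (e 0))" by (intro fo_rules foR(2))
    show "\<exists>!y. y \<in>\<^sub>V D \<and> R y x" if "x \<in>\<^sub>V a" for x
      using that inj unfolding a by blast
  qed blast
  then obtain f where f: "is_fun f a D" "\<And>i y. opair i y \<in>\<^sub>V f \<longleftrightarrow> i \<in>\<^sub>V a \<and> y \<in>\<^sub>V D \<and> R y i" by blast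
  have "\<exists>i. opair i y \<in>\<^sub>V f" if "y \<in>\<^sub>V D" for y
    using that IH unfolding f(2) a R_def by blast
  then have "enum f a D"
    unfolding enum_def using f \<open>Ord a\<close> order by auto
  then show ?thesis by blast
qed

text \<open>The induction runs along the bound y and treats the segments of \<open>D\<close> below
  y; one more step passes from these segments to \<open>D\<close> itself.\<close>

lemma ex_enum:
  assumes D: "\<And>x. x \<in>\<^sub>V D \<Longrightarrow> Ord x" shows "\<exists>\<alpha> f. enum f \<alpha> D"
proof (rule ex_enum_step[OF D])
  fix y assume "y \<in>\<^sub>V D"
  then have "Ord y" by (rule D)
  then show "\<exists>\<alpha> f. enum f \<alpha> (below D y)"
  proof (rule Ord_induct_fo[rotated])
    show "fo (\<lambda>e. \<exists>\<alpha> f. enum f \<alpha> (below D (e 0)))" by (intro fo_rules)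
  next
    fix y assume y: "Ord y" and IH: "\<And>x. x \<in>\<^sub>V y \<Longrightarrow> \<exists>\<alpha> f. enum f \<alpha> (below D x)"
    show "\<exists>\<alpha> f. enum f \<alpha> (below D y)"
    proof (rule ex_enum_step)
      fix x assume "x \<in>\<^sub>V below D y"
      then have x: "x \<in>\<^sub>V D" "x \<in>\<^sub>V y" unfolding mem_below by blast+
      have "below (below D y) x = below D x"
        by (rule eqI) (use x(2) Ord_trans[OF y] in \<open>auto simp: mem_below\<close>)
      then show "\<exists>\<alpha> f. enum f \<alpha> (below (below D y) x)" using IH[OF x(2)] by simp
    qed (use D in \<open>auto simp: mem_below\<close>)
  qed
qed

subsection \<open>Filters and the completeness of the normal ultrafilter\<close>

abbreviation (input) almost :: "'v::zf \<Rightarrow> 'v \<Rightarrow> ('v \<Rightarrow> bool) \<Rightarrow> bool" where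
  "almost Y F P \<equiv> Sep Y P \<in>\<^sub>V F"

text \<open>Both sides give \<open>Coll\<close> the same predicate, before any set is known to
  exist. This is what allows \<open>app\<close> to be replaced by a definable relation inside
  \<open>Sep\<close>.\<close>

lemma Sep_cong: "(\<And>x. x \<in>\<^sub>V a \<Longrightarrow> P x \<longleftrightarrow> Q x) \<Longrightarrow> Sep a P = Sep a Q"
  unfolding Sep_def by (rule arg_cong[of _ _ Coll]) auto

lemma filter_mono: "filter_on Y F \<Longrightarrow> A \<in>\<^sub>V F \<Longrightarrow> A \<subseteq>\<^sub>V B \<Longrightarrow> B \<subseteq>\<^sub>V Y \<Longrightarrow> B \<in>\<^sub>V F"
  unfolding filter_on_def by blast

lemma filter_subset: "filter_on Y F \<Longrightarrow> A \<in>\<^sub>V F \<Longrightarrow> A \<subseteq>\<^sub>V Y"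
  unfolding filter_on_def vsubset_def[of F] mem_vpow by blast

lemma Sep_mem: "A \<subseteq>\<^sub>V Y \<Longrightarrow> Sep Y (\<lambda>x. x \<in>\<^sub>V A) = A"
  by (rule eqI) (auto simp: vsubset_def mem_below)

lemma almost_mem_iff: "filter_on Y F \<Longrightarrow> A \<subseteq>\<^sub>V Y \<Longrightarrow> almost Y F (\<lambda>x. x \<in>\<^sub>V A) \<longleftrightarrow> A \<in>\<^sub>V F"
  by (simp add: Sep_mem)

lemma almost_mono:
  assumes "filter_on Y F" "almost Y F P" "fo (\<lambda>e. P (e 0))" "fo (\<lambda>e. Q (e 0))"
    and "\<And>y. y \<in>\<^sub>V Y \<Longrightarrow> P y \<Longrightarrow> Q y"
  shows "almost Y F Q"
  by (rule filter_mono[OF assms(1,2)]; rule vsubsetI)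
    (use assms(5) in \<open>auto simp: mem_Sep[of P, OF assms(3)] mem_Sep[of Q, OF assms(4)]\<close>)

lemma almost_conj:
  assumes "filter_on Y F" "almost Y F P" "almost Y F Q" "fo (\<lambda>e. P (e 0))" "fo (\<lambda>e. Q (e 0))"
  shows "almost Y F (\<lambda>y. P y \<and> Q y)"
proof -
  have "Sep (Sep Y P) (\<lambda>x. x \<in>\<^sub>V Sep Y Q) \<in>\<^sub>V F"
    using assms(1-3) unfolding filter_on_def by blast
  moreover have "fo (\<lambda>e. P (e 0) \<and> Q (e 0))" by (intro fo_rules assms)
  then have "Sep (Sep Y P) (\<lambda>x. x \<in>\<^sub>V Sep Y Q) = Sep Y (\<lambda>y. P y \<and> Q y)"
    by (intro eqI, unfold mem_below) (auto simp: mem_Sep[of P, OF assms(4)] mem_Sep[of Q, OF assms(5)]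
        mem_Sep[of "\<lambda>y. P y \<and> Q y"])
  ultimately show ?thesis by simp
qed

lemma almost_all:
  assumes "filter_on Y F" "\<And>y. y \<in>\<^sub>V Y \<Longrightarrow> P y" "fo (\<lambda>e. P (e 0))"
  shows "almost Y F P"
proof -
  have "Sep Y P = Y" by (rule eqI) (use assms(2) mem_Sep[of P, OF assms(3)] in blast)
  then show ?thesis using assms(1) unfolding filter_on_def by simp
qed

lemma almost_ex:
  assumes "filter_on Y F" "almost Y F P" "fo (\<lambda>e. P (e 0))"
  shows "\<exists>y. y \<in>\<^sub>V Y \<and> P y"
  using assms(1,2) mem_Sep[of P, OF assms(3)] unfolding filter_on_def nonempty_def by blast

lemma almost_ultra:
  assumes "ultrafilter_on Y F" "fo (\<lambda>e. P (e 0))" "\<not> almost Y F P"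
  shows "almost Y F (\<lambda>x. \<not> P x)"
proof -
  have "Sep Y P \<subseteq>\<^sub>V Y" by (simp add: vsubset_def mem_Sep[of P, OF assms(2)])
  then have "Sep Y (\<lambda>x. \<not> x \<in>\<^sub>V Sep Y P) \<in>\<^sub>V F"
    using assms(1,3) unfolding ultrafilter_on_def by blast
  moreover have "Sep Y (\<lambda>x. \<not> x \<in>\<^sub>V Sep Y P) = Sep Y (\<lambda>x. \<not> P x)"
    by (rule Sep_cong) (simp add: mem_Sep[of P, OF assms(2)])
  ultimately show ?thesis by simp
qed

lemma fot_Sep_param:
  assumes "fo (\<lambda>e. \<Phi> (e 0) (e 1))" shows "fo (\<lambda>e. e 0 = Sep Y (\<Phi> (e 1)))"
  by (rule fo_eq[OF fot_var], rule fot_Sep[OF fot_const], rule fo_comp2[OF assms], (rule fot_var)+)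

text \<open>To form a sequence of members of \<open>F\<close> without choice, its terms must be
  given uniformly; the definable \<open>\<Phi>\<close> does this, and Replacement collects
  them.\<close>

lemma almost_ball_complete:
  assumes "is_complete Y F \<kappa>" "\<beta> \<in>\<^sub>V \<kappa>" and \<Phi>: "fo (\<lambda>e. \<Phi> (e 0) (e 1))"
    and "\<And>i. i \<in>\<^sub>V \<beta> \<Longrightarrow> almost Y F (\<Phi> i)"
  shows "almost Y F (\<lambda>y. \<forall>i. i \<in>\<^sub>V \<beta> \<longrightarrow> \<Phi> i y)"
proof -
  have mem: "y \<in>\<^sub>V Sep Y (\<Phi> i) \<longleftrightarrow> y \<in>\<^sub>V Y \<and> \<Phi> i y" for i y
    by (rule mem_Sep, rule fo_comp2[OF \<Phi>]) (intro fo_rules)+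
  obtain A where A: "is_fun A \<beta> F" "\<And>i. i \<in>\<^sub>V \<beta> \<Longrightarrow> app A i = Sep Y (\<Phi> i)"
    using ex_fun[of "\<lambda>i. Sep Y (\<Phi> i)", OF fot_Sep_param[OF \<Phi>], of \<beta> F] assms(4) by blast
  then have "almost Y F (\<lambda>y. \<forall>i. i \<in>\<^sub>V \<beta> \<longrightarrow> y \<in>\<^sub>V app A i)"
    using assms(1,2) unfolding is_complete_def by blast
  moreover have "Sep Y (\<lambda>y. \<forall>i. i \<in>\<^sub>V \<beta> \<longrightarrow> y \<in>\<^sub>V app A i) = Sep Y (\<lambda>y. \<forall>i. i \<in>\<^sub>V \<beta> \<longrightarrow> \<Phi> i y)"
    by (rule Sep_cong) (simp add: A(2) mem)
  ultimately show ?thesis by simp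
qed

lemma almost_ball_normal:
  assumes "is_normal Z U" and \<Phi>: "fo (\<lambda>e. \<Phi> (e 0) (e 1))"
    and "\<And>x. x \<in>\<^sub>V Z \<Longrightarrow> almost (vpow Z) U (\<Phi> x)"
  shows "almost (vpow Z) U (\<lambda>s. \<forall>x. x \<in>\<^sub>V s \<longrightarrow> \<Phi> x s)"
proof -
  have mem: "y \<in>\<^sub>V Sep (vpow Z) (\<Phi> i) \<longleftrightarrow> y \<in>\<^sub>V vpow Z \<and> \<Phi> i y" for i y
    by (rule mem_Sep, rule fo_comp2[OF \<Phi>]) (intro fo_rules)+
  obtain A where A: "is_fun A Z U" "\<And>x. x \<in>\<^sub>V Z \<Longrightarrow> app A x = Sep (vpow Z) (\<Phi> x)"
    using ex_fun[of "\<lambda>i. Sep (vpow Z) (\<Phi> i)", OF fot_Sep_param[OF \<Phi>], of Z U] assms(3) by blast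
  then have "almost (vpow Z) U (\<lambda>s. \<forall>x. x \<in>\<^sub>V s \<longrightarrow> s \<in>\<^sub>V app A x)"
    using assms(1) unfolding is_normal_def by blast
  moreover have "Sep (vpow Z) (\<lambda>s. \<forall>x. x \<in>\<^sub>V s \<longrightarrow> s \<in>\<^sub>V app A x)
    = Sep (vpow Z) (\<lambda>s. \<forall>x. x \<in>\<^sub>V s \<longrightarrow> \<Phi> x s)"
  proof (rule Sep_cong)
    fix s assume s: "s \<in>\<^sub>V vpow Z"
    then have "app A x = Sep (vpow Z) (\<Phi> x)" if "x \<in>\<^sub>V s" for x
      using A(2) that unfolding mem_vpow vsubset_def by blast
    then show "(\<forall>x. x \<in>\<^sub>V s \<longrightarrow> s \<in>\<^sub>V app A x) \<longleftrightarrow> (\<forall>x. x \<in>\<^sub>V s \<longrightarrow> \<Phi> x s)"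
      using s mem by auto
  qed
  ultimately show ?thesis by simp
qed

section \<open>The completeness cardinal as the least incomplete length\<close>

text \<open>Avoiding \<open>app\<close> makes this definable in \<beta>, so that a least such length
  exists; by \<open>is_complete_iff\<close> it governs all degrees of completeness.\<close>

definition incomplete_at :: "'v::zf \<Rightarrow> 'v \<Rightarrow> 'v \<Rightarrow> bool" where
  "incomplete_at Y U \<beta> \<longleftrightarrow> (\<exists>A. is_fun A \<beta> U \<and>
    \<not> almost Y U (\<lambda>y. \<forall>i B. opair i B \<in>\<^sub>V A \<longrightarrow> y \<in>\<^sub>V B))"

lemma fo_incomplete_at: "fo (\<lambda>e. incomplete_at Y U (e 0))"
  unfolding incomplete_at_def by (intro fo_rules)

lemma Sep_app_eq:
  assumes "is_fun A \<beta> U"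
  shows "Sep Y (\<lambda>y. \<forall>i. i \<in>\<^sub>V \<beta> \<longrightarrow> y \<in>\<^sub>V app A i) = Sep Y (\<lambda>y. \<forall>i B. opair i B \<in>\<^sub>V A \<longrightarrow> y \<in>\<^sub>V B)"
  unfolding opair_mem_iff[OF assms] by (rule Sep_cong) blast

lemma is_complete_iff: "is_complete Y U \<mu> \<longleftrightarrow> (\<forall>\<beta>. \<beta> \<in>\<^sub>V \<mu> \<longrightarrow> \<not> incomplete_at Y U \<beta>)"
proof -
  have "(is_fun A \<beta> U \<longrightarrow> almost Y U (\<lambda>y. \<forall>i. i \<in>\<^sub>V \<beta> \<longrightarrow> y \<in>\<^sub>V app A i)) \<longleftrightarrow>
    (is_fun A \<beta> U \<longrightarrow> almost Y U (\<lambda>y. \<forall>i B. opair i B \<in>\<^sub>V A \<longrightarrow> y \<in>\<^sub>V B))" for A \<beta>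
    using Sep_app_eq[of A \<beta> U Y] by auto
  then show ?thesis unfolding is_complete_def incomplete_at_def by blast
qed

text \<open>Reindexing along a bijection preserves the range of a sequence and so its intersection.
  Hence the least incomplete length is a cardinal.\<close>

lemma incomplete_at_bij:
  assumes "incomplete_at Y U \<kappa>" "is_bij f \<beta> \<kappa>" shows "incomplete_at Y U \<beta>"
proof -
  obtain A where A: "is_fun A \<kappa> U" "\<not> almost Y U (\<lambda>y. \<forall>i B. opair i B \<in>\<^sub>V A \<longrightarrow> y \<in>\<^sub>V B)"
    using assms(1) unfolding incomplete_at_def by blast
  have f: "is_fun f \<beta> \<kappa>" "\<And>y. y \<in>\<^sub>V \<kappa> \<Longrightarrow> \<exists>x. opair x y \<in>\<^sub>V f"
    using assms(2) unfolding is_bij_iff is_inj_iff by blast+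
  have "\<exists>A'. is_fun A' \<beta> U \<and>
    (\<forall>x B. opair x B \<in>\<^sub>V A' \<longleftrightarrow> x \<in>\<^sub>V \<beta> \<and> (\<exists>i. opair x i \<in>\<^sub>V f \<and> opair i B \<in>\<^sub>V A))"
  proof (rule ex_fun_rel)
    show "\<exists>!B. \<exists>i. opair x i \<in>\<^sub>V f \<and> opair i B \<in>\<^sub>V A" if "x \<in>\<^sub>V \<beta>" for x
      using app_mem[OF f(1) that] that unfolding opair_mem_iff[OF f(1)] opair_mem_iff[OF A(1)] by blast
    show "B \<in>\<^sub>V U" if "\<exists>i. opair x i \<in>\<^sub>V f \<and> opair i B \<in>\<^sub>V A" for x B
      using that app_mem[OF A(1)] unfolding opair_mem_iff[OF A(1)] by blast
  qed (intro fo_rules)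
  then obtain A' where A': "is_fun A' \<beta> U"
    "\<And>x B. opair x B \<in>\<^sub>V A' \<longleftrightarrow> x \<in>\<^sub>V \<beta> \<and> (\<exists>i. opair x i \<in>\<^sub>V f \<and> opair i B \<in>\<^sub>V A)" by blast
  have "(\<exists>x. opair x B \<in>\<^sub>V A') \<longleftrightarrow> (\<exists>i. opair i B \<in>\<^sub>V A)" for B
    unfolding A'(2) using f(2) unfolding opair_mem_iff[OF A(1)] opair_mem_iff[OF f(1)] by blast
  then have "(\<forall>i B. opair i B \<in>\<^sub>V A \<longrightarrow> y \<in>\<^sub>V B) \<longleftrightarrow> (\<forall>i B. opair i B \<in>\<^sub>V A' \<longrightarrow> y \<in>\<^sub>V B)" for y
    by metis
  then show ?thesis unfolding incomplete_at_def using A'(1) A(2) by auto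
qed

lemma nonprincipal_fine_incomplete:
  assumes "ultrafilter_on (vpow \<delta>) U" "\<not> is_principal (vpow \<delta>) U" "is_fine \<delta> U"
  shows "incomplete_at (vpow \<delta>) U \<delta>"
proof (rule ccontr)
  assume complete: "\<not> ?thesis"
  have filt: "filter_on (vpow \<delta>) U" using assms(1) unfolding ultrafilter_on_def by blast
  have "fo (\<lambda>e. e 0 = Sep (vpow \<delta>) (\<lambda>\<sigma>. e 1 \<in>\<^sub>V \<sigma>))" by (intro fo_rules)
  then obtain A where A: "is_fun A \<delta> U" "\<And>x. x \<in>\<^sub>V \<delta> \<Longrightarrow> app A x = Sep (vpow \<delta>) (\<lambda>\<sigma>. x \<in>\<^sub>V \<sigma>)"
    using ex_fun[of "\<lambda>x. Sep (vpow \<delta>) (\<lambda>\<sigma>. x \<in>\<^sub>V \<sigma>)" \<delta> U] assms(3) unfolding is_fine_def by blast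
  have mem: "y \<in>\<^sub>V Sep (vpow \<delta>) (\<lambda>\<sigma>. x \<in>\<^sub>V \<sigma>) \<longleftrightarrow> y \<in>\<^sub>V vpow \<delta> \<and> x \<in>\<^sub>V y" for x y
    by (rule mem_Sep) (intro fo_rules)
  have "almost (vpow \<delta>) U (\<lambda>y. \<forall>i. i \<in>\<^sub>V \<delta> \<longrightarrow> y \<in>\<^sub>V app A i)"
    using complete A(1) unfolding incomplete_at_def Sep_app_eq[OF A(1)] by blast
  moreover have "Sep (vpow \<delta>) (\<lambda>y. \<forall>i. i \<in>\<^sub>V \<delta> \<longrightarrow> y \<in>\<^sub>V app A i)
    = Sep (vpow \<delta>) (\<lambda>y. y = \<delta>)"
    by (rule Sep_cong) (auto simp: A(2) mem mem_vpow vsubset_def intro: eqI)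
  ultimately have \<delta>: "almost (vpow \<delta>) U (\<lambda>y. y = \<delta>)" by simp
  have "U = Sep (vpow (vpow \<delta>)) (\<lambda>A. \<delta> \<in>\<^sub>V A)"
  proof (rule eqI)
    fix B
    have memB: "B \<in>\<^sub>V Sep (vpow (vpow \<delta>)) (\<lambda>A. \<delta> \<in>\<^sub>V A) \<longleftrightarrow> B \<subseteq>\<^sub>V vpow \<delta> \<and> \<delta> \<in>\<^sub>V B"
      unfolding mem_vpow[symmetric] by (rule mem_Sep) (intro fo_rules)
    show "B \<in>\<^sub>V U \<longleftrightarrow> B \<in>\<^sub>V Sep (vpow (vpow \<delta>)) (\<lambda>A. \<delta> \<in>\<^sub>V A)"
      unfolding memB
    proof
      assume B: "B \<in>\<^sub>V U"
      then have sub: "B \<subseteq>\<^sub>V vpow \<delta>" using filter_subset[OF filt] by blast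
      then have "almost (vpow \<delta>) U (\<lambda>y. y \<in>\<^sub>V B)" using B almost_mem_iff[OF filt] by blast
      from almost_conj[OF filt this \<delta>] have "almost (vpow \<delta>) U (\<lambda>y. y \<in>\<^sub>V B \<and> y = \<delta>)"
        by this (intro fo_rules)+
      then have "\<exists>y. y \<in>\<^sub>V vpow \<delta> \<and> y \<in>\<^sub>V B \<and> y = \<delta>"
        by (rule almost_ex[OF filt]) (intro fo_rules)
      then show "B \<subseteq>\<^sub>V vpow \<delta> \<and> \<delta> \<in>\<^sub>V B" using sub by blast
    next
      assume B: "B \<subseteq>\<^sub>V vpow \<delta> \<and> \<delta> \<in>\<^sub>V B"
      have "almost (vpow \<delta>) U (\<lambda>y. y \<in>\<^sub>V B)"
        by (rule almost_mono[OF filt \<delta>], (intro fo_rules)+) (use B in blast)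
      then show "B \<in>\<^sub>V U" using B almost_mem_iff[OF filt] by blast
    qed
  qed
  moreover have "\<delta> \<in>\<^sub>V vpow \<delta>" by (simp add: mem_vpow vsubset_def)
  ultimately show False using assms(2) unfolding is_principal_def by blast
qed

text \<open>Up to the least incomplete length \<mu> no sequence fails, so \<open>U\<close> is
  \<mu>-complete; a larger cardinal would have the failing length \<mu> as a member.\<close>

lemma completeness_works:
  assumes "Ord \<delta>" "incomplete_at Y U \<delta>"
  defines "\<kappa> \<equiv> completeness Y U"
  shows "Ord \<kappa>" "\<kappa> \<subseteq>\<^sub>V \<delta>" "incomplete_at Y U \<kappa>"
proof -
  obtain \<mu> where \<mu>: "Ord \<mu>" "incomplete_at Y U \<mu>" "\<And>\<beta>. \<beta> \<in>\<^sub>V \<mu> \<Longrightarrow> \<not> incomplete_at Y U \<beta>"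
    using ex_least_Ord[of "incomplete_at Y U", OF fo_incomplete_at assms(1,2)] by blast
  let ?C = "\<lambda>\<kappa>. Card \<kappa> \<and> is_complete Y U \<kappa> \<and>
    (\<forall>\<mu>. Card \<mu> \<and> is_complete Y U \<mu> \<longrightarrow> \<mu> \<in>\<^sub>V \<kappa> \<or> \<mu> = \<kappa>)"
  have C: "Card \<mu>" "is_complete Y U \<mu>"
    using \<mu> incomplete_at_bij unfolding Card_def is_complete_iff by blast+
  moreover have max: "\<nu> \<in>\<^sub>V \<mu> \<or> \<nu> = \<mu>" if "Card \<nu>" "is_complete Y U \<nu>" for \<nu>
    using that \<mu>(2) Ord_linear[OF _ \<mu>(1), of \<nu>] unfolding Card_def is_complete_iff by blast
  moreover have "\<nu> = \<mu>" if "?C \<nu>" for \<nu>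
    using that C max Ord_trans[OF \<mu>(1)] not_mem_self by blast
  ultimately have "\<kappa> = \<mu>"
    unfolding \<kappa>_def completeness_def by (intro the_equality) blast+
  moreover have "\<mu> \<subseteq>\<^sub>V \<delta>"
    using Ord_linear[OF assms(1) \<mu>(1)] \<mu>(3) assms(2) Ord_trans[OF assms(1)] by (auto intro: vsubsetI)
  ultimately show "Ord \<kappa>" "\<kappa> \<subseteq>\<^sub>V \<delta>" "incomplete_at Y U \<kappa>" using \<mu> by simp_all
qed

lemma fot_vpow [fo_rules]:
  assumes "fot s" shows "fot (\<lambda>e. vpow (s e))"
proof (rule fot_comp1[OF _ assms])
  have "x = vpow y \<longleftrightarrow> (\<forall>w. w \<in>\<^sub>V x \<longleftrightarrow> w \<subseteq>\<^sub>V y)" for x y :: 'a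
    using mem_vpow[of _ y] eqI[of x "vpow y"] by auto
  moreover have "fo (\<lambda>e :: nat \<Rightarrow> 'a. \<forall>w. w \<in>\<^sub>V e 0 \<longleftrightarrow> w \<subseteq>\<^sub>V e 1)"
    by (intro fo_rules)
  ultimately show "fo (\<lambda>e :: nat \<Rightarrow> 'a. e 0 = vpow (e 1))" by simp
qed

text \<open>This makes the smallness condition on \<sigma> definable, so that it can be intersected
  with other conditions.\<close>

lemma fot_hartogs [fo_rules]:
  assumes "fot s" shows "fot (\<lambda>e. hartogs (s e))"
proof (rule fot_comp1[OF _ assms])
  have "x = hartogs y \<longleftrightarrow> Ord x \<and> \<not> (\<exists>f. is_inj f x y) \<and> (\<forall>\<beta>. \<beta> \<in>\<^sub>V x \<longrightarrow> (\<exists>f. is_inj f \<beta> y))"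
    for x y :: 'a
    using hartogs_works(1)[of y] hartogs_works(2)[where Z = y] hartogs_works(3)[where Z = y]
      Ord_linear[of x "hartogs y"] by blast
  moreover have "fo (\<lambda>e :: nat \<Rightarrow> 'a. Ord (e 0) \<and> \<not> (\<exists>f. is_inj f (e 0) (e 1)) \<and>
    (\<forall>\<beta>. \<beta> \<in>\<^sub>V e 0 \<longrightarrow> (\<exists>f. is_inj f \<beta> (e 1))))"
    by (intro fo_rules)
  ultimately show "fo (\<lambda>e :: nat \<Rightarrow> 'a. e 0 = hartogs (e 1))" by simp
qed

subsection \<open>Classes of points with the same memberships\<close>

definition eqv :: "'v::zf \<Rightarrow> 'v \<Rightarrow> 'v \<Rightarrow> bool" where
  "eqv \<sigma> x y \<longleftrightarrow> (\<forall>A. A \<in>\<^sub>V \<sigma> \<longrightarrow> (x \<in>\<^sub>V A \<longleftrightarrow> y \<in>\<^sub>V A))"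

lemma fo_eqv [fo_rules]: "fot r \<Longrightarrow> fot s \<Longrightarrow> fot t \<Longrightarrow> fo (\<lambda>e. eqv (r e) (s e) (t e))"
  by (rule fo_comp3[of eqv]) (unfold eqv_def, intro fo_rules)

lemma eqv_refl: "eqv \<sigma> x x"
  and eqv_sym: "eqv \<sigma> x y \<Longrightarrow> eqv \<sigma> y x"
  and eqv_trans: "eqv \<sigma> x y \<Longrightarrow> eqv \<sigma> y z \<Longrightarrow> eqv \<sigma> x z"
  unfolding eqv_def by blast+

definition least_in_class :: "'v::zf \<Rightarrow> 'v \<Rightarrow> bool" where
  "least_in_class \<sigma> x \<longleftrightarrow> (\<forall>y. y \<in>\<^sub>V x \<longrightarrow> \<not> eqv \<sigma> x y)"

lemma fo_least_in_class [fo_rules]: "fot r \<Longrightarrow> fot s \<Longrightarrow> fo (\<lambda>e. least_in_class (r e) (s e))"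
  by (rule fo_comp2[of least_in_class]) (unfold least_in_class_def, intro fo_rules)

lemma least_in_class_unique:
  assumes "Ord x" "Ord y" "least_in_class \<sigma> x" "least_in_class \<sigma> y" "eqv \<sigma> x y"
  shows "x = y"
  using assms Ord_linear[of x y] eqv_sym[of \<sigma> x y] unfolding least_in_class_def by blast

lemma ex_least_in_class:
  assumes "y \<in>\<^sub>V \<delta>" "Ord \<delta>" shows "\<exists>x. x \<in>\<^sub>V \<delta> \<and> eqv \<sigma> x y \<and> least_in_class \<sigma> x"
proof -
  have "fo (\<lambda>e. eqv \<sigma> (e 0) y)" by (intro fo_rules)
  then obtain m where m: "m \<in>\<^sub>V \<delta>" "eqv \<sigma> m y" "\<And>z. z \<in>\<^sub>V m \<Longrightarrow> z \<in>\<^sub>V \<delta> \<Longrightarrow> \<not> eqv \<sigma> z y"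
    using ex_minimal[of "\<lambda>x. eqv \<sigma> x y" y \<delta>] assms(1) eqv_refl by blast
  have "\<not> eqv \<sigma> m z" if "z \<in>\<^sub>V m" for z
    using m(2) m(3)[OF that Ord_trans[OF assms(2) m(1) that]] eqv_sym eqv_trans by blast
  then show ?thesis using m unfolding least_in_class_def by blast
qed

text \<open>For a filter \<open>F\<close> on \<delta> the witness y lies in \<delta>, so this is
  positivity of \<open>eqv_class \<delta> \<sigma> x\<close>.\<close>

definition positive_class :: "'v::zf \<Rightarrow> 'v \<Rightarrow> 'v \<Rightarrow> bool" where
  "positive_class F \<sigma> x \<longleftrightarrow> (\<forall>B. B \<in>\<^sub>V F \<longrightarrow> (\<exists>y. y \<in>\<^sub>V B \<and> eqv \<sigma> x y))"

lemma fo_positive_class [fo_rules]: "fot s \<Longrightarrow> fot t \<Longrightarrow> fo (\<lambda>e. positive_class F (s e) (t e))"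
  by (rule fo_comp2[of "positive_class F"]) (unfold positive_class_def, intro fo_rules)

definition reps :: "'v::zf \<Rightarrow> 'v \<Rightarrow> 'v \<Rightarrow> 'v" where
  "reps \<delta> F \<sigma> = Sep \<delta> (\<lambda>x. least_in_class \<sigma> x \<and> positive_class F \<sigma> x)"

lemma mem_reps: "x \<in>\<^sub>V reps \<delta> F \<sigma> \<longleftrightarrow> x \<in>\<^sub>V \<delta> \<and> least_in_class \<sigma> x \<and> positive_class F \<sigma> x"
  unfolding reps_def by (rule mem_Sep) (intro fo_rules)

lemma fot_reps [fo_rules]:
  assumes "fot s" shows "fot (\<lambda>e. reps \<delta> F (s e))"
  by (rule fot_comp1[OF _ assms]) (unfold reps_def, intro fo_rules)

text \<open>A relation instead of a term, as \<sigma> may have too few positive classes. Quantifying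
  over enumerations involves no choice because they are unique.\<close>

definition nth_rep :: "'v::zf \<Rightarrow> 'v \<Rightarrow> 'v \<Rightarrow> 'v \<Rightarrow> 'v \<Rightarrow> bool" where
  "nth_rep \<delta> F \<sigma> i x \<longleftrightarrow> (\<exists>\<eta> f. enum f \<eta> (reps \<delta> F \<sigma>) \<and> opair i x \<in>\<^sub>V f)"

lemma fo_nth_rep [fo_rules]:
  "fot r \<Longrightarrow> fot s \<Longrightarrow> fot t \<Longrightarrow> fo (\<lambda>e. nth_rep \<delta> F (r e) (s e) (t e))"
  by (rule fo_comp3[of "nth_rep \<delta> F"]) (unfold nth_rep_def, intro fo_rules)

text \<open>For fixed \<open>i\<close> the sets \<open>A\<close> with \<open>lim_mem \<delta> F W i A\<close> form the image of \<open>W\<close> under the map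
  taking \<open>\<sigma>\<close> to the least element of the \<open>i\<close>-th positive class of \<open>\<sigma>\<close>; there is no such \<open>A\<close> if
  almost no \<open>\<sigma>\<close> has an \<open>i\<close>-th positive class.\<close>

definition lim_mem :: "'v::zf \<Rightarrow> 'v \<Rightarrow> 'v \<Rightarrow> 'v \<Rightarrow> 'v \<Rightarrow> bool" where
  "lim_mem \<delta> F W i A \<longleftrightarrow> almost (vpow (vpow \<delta>)) W (\<lambda>\<sigma>. \<exists>x. nth_rep \<delta> F \<sigma> i x \<and> x \<in>\<^sub>V A)"

lemma fo_lim_mem [fo_rules]: "fot s \<Longrightarrow> fot t \<Longrightarrow> fo (\<lambda>e. lim_mem \<delta> F W (s e) (t e))"
  by (rule fo_comp2[of "lim_mem \<delta> F W"]) (unfold lim_mem_def, intro fo_rules)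

lemma fo_in_lim_mem: "fo (\<lambda>e. \<exists>x. nth_rep \<delta> F (e 0) i x \<and> x \<in>\<^sub>V A)"
  by (intro fo_rules)

definition eqv_class :: "'v::zf \<Rightarrow> 'v \<Rightarrow> 'v \<Rightarrow> 'v" where
  "eqv_class \<delta> \<sigma> x = Sep \<delta> (eqv \<sigma> x)"

lemma mem_eqv_class: "y \<in>\<^sub>V eqv_class \<delta> \<sigma> x \<longleftrightarrow> y \<in>\<^sub>V \<delta> \<and> eqv \<sigma> x y"
  unfolding eqv_class_def by (rule mem_Sep) (intro fo_rules)

lemma fot_eqv_class [fo_rules]:
  assumes "fot s" "fot t" shows "fot (\<lambda>e. eqv_class \<delta> (s e) (t e))"
  by (rule fot_comp2[OF _ assms]) (unfold eqv_class_def, intro fo_rules)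

text \<open>Here \<kappa> stands for the completeness of \<open>U\<close> and \<nu> for its cardinal
  successor: at length \<kappa> some intersection leaves \<open>U\<close>, while \<open>W\<close> is
  still closed under intersections of that length.\<close>

locale normal_and_fine_ultrafilters =
  fixes \<delta> \<epsilon> U F W \<kappa> \<nu> :: "'v::zf"
  assumes Ord_\<delta>: "Ord \<delta>" and Ord_\<epsilon>: "Ord \<epsilon>"
    and ultra_U: "ultrafilter_on (vpow \<delta>) U" and normal: "is_normal \<delta> U" and fine_U: "is_fine \<delta> U"
    and filter_F: "filter_on \<delta> F" and complete_F: "is_complete \<delta> F \<epsilon>" and F_in_U: "F \<in>\<^sub>V U"
    and Ord_\<kappa>: "Ord \<kappa>" and \<kappa>_sub: "\<kappa> \<subseteq>\<^sub>V \<delta>" and incomplete: "incomplete_at (vpow \<delta>) U \<kappa>"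
    and ultra_W: "ultrafilter_on (vpow (vpow \<delta>)) W" and fine_W: "is_fine (vpow \<delta>) W"
    and \<kappa>_\<nu>: "\<kappa> \<in>\<^sub>V \<nu>" and complete_W: "is_complete (vpow (vpow \<delta>)) W \<nu>"
    and small: "almost (vpow (vpow \<delta>)) W (\<lambda>\<sigma>. hartogs (vpow \<sigma>) \<in>\<^sub>V \<epsilon>)"
begin

lemma filter_U: "filter_on (vpow \<delta>) U"
  using ultra_U unfolding ultrafilter_on_def by blast

lemma filter_W: "filter_on (vpow (vpow \<delta>)) W"
  using ultra_W unfolding ultrafilter_on_def by blast

lemma F_sub: "B \<in>\<^sub>V F \<Longrightarrow> y \<in>\<^sub>V B \<Longrightarrow> y \<in>\<^sub>V \<delta>"
  using filter_subset[OF filter_F] unfolding vsubset_def by blast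

lemma \<delta>_in_F: "\<delta> \<in>\<^sub>V F"
  using filter_F unfolding filter_on_def by blast

abbreviation "reps' \<equiv> reps \<delta> F"
abbreviation "nth' \<equiv> nth_rep \<delta> F"
abbreviation "lim' \<equiv> lim_mem \<delta> F W"

text \<open>Take a sequence of length \<kappa> in \<open>U\<close> whose intersection is not in
  \<open>U\<close>. Its diagonal intersection is in \<open>U\<close> by normality, and an s
  including \<kappa> that lies in the diagonal intersection lies in every term.\<close>

lemma not_almost_superset: "\<not> almost (vpow \<delta>) U (\<lambda>s. \<kappa> \<subseteq>\<^sub>V s)"
proof
  assume sup: "almost (vpow \<delta>) U (\<lambda>s. \<kappa> \<subseteq>\<^sub>V s)"
  obtain A where A: "is_fun A \<kappa> U" "\<not> almost (vpow \<delta>) U (\<lambda>s. \<forall>i B. opair i B \<in>\<^sub>V A \<longrightarrow> s \<in>\<^sub>V B)"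
    using incomplete unfolding incomplete_at_def by blast
  have fo: "fo (\<lambda>e. \<forall>B. opair x B \<in>\<^sub>V A \<longrightarrow> e 0 \<in>\<^sub>V B)" for x by (intro fo_rules)
  have "almost (vpow \<delta>) U (\<lambda>s. \<forall>B. opair x B \<in>\<^sub>V A \<longrightarrow> s \<in>\<^sub>V B)" for x
  proof (cases "x \<in>\<^sub>V \<kappa>")
    case True
    have Ax: "app A x \<in>\<^sub>V U" using app_mem[OF A(1) True] by blast
    then have "almost (vpow \<delta>) U (\<lambda>s. s \<in>\<^sub>V app A x)"
      using almost_mem_iff[OF filter_U filter_subset[OF filter_U Ax]] by blast
    then show ?thesis
      by (rule almost_mono[OF filter_U]) (intro fo_rules, rule fo, simp add: opair_mem_iff[OF A(1)])
  next
    case False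
    \<comment> \<open>Normality asks for a family indexed by all of \<delta>; indices outside
      \<kappa> carry no constraint.\<close>
    show ?thesis
      by (rule almost_all[OF filter_U _ fo]) (use False opair_mem_iff[OF A(1)] in blast)
  qed
  then have "almost (vpow \<delta>) U (\<lambda>s. \<forall>x. x \<in>\<^sub>V s \<longrightarrow> (\<forall>B. opair x B \<in>\<^sub>V A \<longrightarrow> s \<in>\<^sub>V B))"
    by (intro almost_ball_normal[OF normal] fo_rules)
  from almost_conj[OF filter_U sup this]
  have "almost (vpow \<delta>) U (\<lambda>s. \<kappa> \<subseteq>\<^sub>V s \<and> (\<forall>x. x \<in>\<^sub>V s \<longrightarrow> (\<forall>B. opair x B \<in>\<^sub>V A \<longrightarrow> s \<in>\<^sub>V B)))"
    by this (intro fo_rules)+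
  then have "almost (vpow \<delta>) U (\<lambda>s. \<forall>i B. opair i B \<in>\<^sub>V A \<longrightarrow> s \<in>\<^sub>V B)"
    by (rule almost_mono[OF filter_U], (intro fo_rules)+)
      (unfold opair_mem_iff[OF A(1)] vsubset_def, blast)
  with A(2) show False ..
qed

text \<open>Almost every \<open>s\<close> is a member of \<open>F\<close> and closed under the map sending \<open>x\<close> to the index of the
  set containing \<open>x\<close>.  Such an \<open>s\<close> meets all the sets, so it contains all indices.\<close>

lemma no_disjoint_positive_family:
  assumes R: "fo (\<lambda>e. R (e 0) (e 1))"
    and disj: "\<And>i j x. i \<in>\<^sub>V \<kappa> \<Longrightarrow> j \<in>\<^sub>V \<kappa> \<Longrightarrow> R i x \<Longrightarrow> R j x \<Longrightarrow> i = j"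
    and pos: "\<And>i B. i \<in>\<^sub>V \<kappa> \<Longrightarrow> B \<in>\<^sub>V F \<Longrightarrow> \<exists>x. x \<in>\<^sub>V B \<and> R i x"
  shows False
proof -
  note foR = fo_comp2[OF R]
  have "almost (vpow \<delta>) U (\<lambda>s. \<forall>i. i \<in>\<^sub>V \<kappa> \<and> R i x \<longrightarrow> i \<in>\<^sub>V s)" for x
  proof (cases "\<exists>i. i \<in>\<^sub>V \<kappa> \<and> R i x")
    case True
    then obtain i where i: "i \<in>\<^sub>V \<kappa>" "R i x" by blast
    \<comment> \<open>The index i lies in \<kappa> and therefore in \<delta>, so fineness of
      \<open>U\<close> applies to it.\<close>
    then have "almost (vpow \<delta>) U (\<lambda>s. i \<in>\<^sub>V s)"
      using fine_U \<kappa>_sub unfolding is_fine_def vsubset_def by blast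
    then show ?thesis
      by (rule almost_mono[OF filter_U], (intro fo_rules foR)+) (use i disj in blast)
  next
    case False
    then show ?thesis by (intro almost_all[OF filter_U] fo_rules foR) blast
  qed
  then have 1: "almost (vpow \<delta>) U (\<lambda>s. \<forall>x. x \<in>\<^sub>V s \<longrightarrow> (\<forall>i. i \<in>\<^sub>V \<kappa> \<and> R i x \<longrightarrow> i \<in>\<^sub>V s))"
    by (intro almost_ball_normal[OF normal] fo_rules foR)
  have 2: "almost (vpow \<delta>) U (\<lambda>s. s \<in>\<^sub>V F)"
    using almost_mem_iff[OF filter_U filter_subset[OF filter_U F_in_U]] F_in_U by blast
  from almost_conj[OF filter_U 2 1]
  have "almost (vpow \<delta>) U (\<lambda>s. s \<in>\<^sub>V F \<and> (\<forall>x. x \<in>\<^sub>V s \<longrightarrow> (\<forall>i. i \<in>\<^sub>V \<kappa> \<and> R i x \<longrightarrow> i \<in>\<^sub>V s)))"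
    by this (intro fo_rules foR)+
  then have "almost (vpow \<delta>) U (\<lambda>s. \<kappa> \<subseteq>\<^sub>V s)"
    by (rule almost_mono[OF filter_U], (intro fo_rules foR)+) (use pos in \<open>unfold vsubset_def, blast\<close>)
  then show False using not_almost_superset by blast
qed

section \<open>Positive and null classes of a single \<sigma>\<close>

lemma reps_Ord: "x \<in>\<^sub>V reps' \<sigma> \<Longrightarrow> Ord x"
  using Ord_mem[OF Ord_\<delta>] unfolding mem_reps by blast

lemma reps_unique: "x \<in>\<^sub>V reps' \<sigma> \<Longrightarrow> y \<in>\<^sub>V reps' \<sigma> \<Longrightarrow> eqv \<sigma> x y \<Longrightarrow> x = y"
  using least_in_class_unique[OF reps_Ord reps_Ord] unfolding mem_reps by blast

text \<open>Otherwise the first \<kappa> positive classes would be a disjoint family of the kind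
  excluded by \<open>no_disjoint_positive_family\<close>.\<close>

lemma enum_reps_length:
  assumes f: "enum f \<eta> (reps' \<sigma>)" shows "\<eta> \<in>\<^sub>V \<kappa>"
proof (rule ccontr)
  assume "\<not> \<eta> \<in>\<^sub>V \<kappa>"
  have fn: "Ord \<eta>" "is_fun f \<eta> (reps' \<sigma>)" using f unfolding enum_def by blast+
  then have sub: "i \<in>\<^sub>V \<eta>" if "i \<in>\<^sub>V \<kappa>" for i
    using \<open>\<not> \<eta> \<in>\<^sub>V \<kappa>\<close> Ord_linear[OF Ord_\<kappa> fn(1)] Ord_trans[OF fn(1)] that by blast
  have mem: "x \<in>\<^sub>V reps' \<sigma>" if "opair i x \<in>\<^sub>V f" for i x
    using that app_mem[OF fn(2)] unfolding opair_mem_iff[OF fn(2)] by blast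
  show False
  proof (rule no_disjoint_positive_family)
    show "fo (\<lambda>e. \<exists>x. opair (e 0) x \<in>\<^sub>V f \<and> eqv \<sigma> x (e 1))" by (intro fo_rules)
    show "i = j" if ex: "\<exists>x. opair i x \<in>\<^sub>V f \<and> eqv \<sigma> x y" "\<exists>x. opair j x \<in>\<^sub>V f \<and> eqv \<sigma> x y" for i j y
    proof -
      obtain x z where xz: "opair i x \<in>\<^sub>V f" "opair j z \<in>\<^sub>V f" "eqv \<sigma> x y" "eqv \<sigma> z y" using ex by blast
      then have "x = z" using reps_unique[OF mem mem, of i x j z] eqv_trans[OF xz(3) eqv_sym] by blast
      then show ?thesis using enum_is_inj[OF f] xz unfolding is_inj_iff by blast
    qed
    show "\<exists>x. x \<in>\<^sub>V B \<and> (\<exists>z. opair i z \<in>\<^sub>V f \<and> eqv \<sigma> z x)" if "i \<in>\<^sub>V \<kappa>" "B \<in>\<^sub>V F" for i B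
      using app_mem[OF fn(2) sub[OF that(1)]] that(2) unfolding mem_reps positive_class_def by blast
  qed
qed

lemma nth_unique: "nth' \<sigma> i x \<Longrightarrow> nth' \<sigma> i y \<Longrightarrow> x = y"
proof -
  assume "nth' \<sigma> i x" "nth' \<sigma> i y"
  then obtain \<eta> f \<theta> g where f: "enum f \<eta> (reps' \<sigma>)" "opair i x \<in>\<^sub>V f"
    and g: "enum g \<theta> (reps' \<sigma>)" "opair i y \<in>\<^sub>V g" unfolding nth_rep_def by blast
  have "opair i x \<in>\<^sub>V g" by (rule enum_unique(2)[OF f(1) g(1) _ f(2)]) (rule reps_Ord)
  moreover have "is_fun g \<theta> (reps' \<sigma>)" using g(1) unfolding enum_def by blast
  ultimately show ?thesis using g(2) opair_mem_iff[of g \<theta> "reps' \<sigma>"] by simp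
qed

lemma nth_mem_reps: "nth' \<sigma> i x \<Longrightarrow> x \<in>\<^sub>V reps' \<sigma>"
  unfolding nth_rep_def enum_def using app_mem opair_mem_iff by metis

lemma ex_nth: assumes "x \<in>\<^sub>V reps' \<sigma>" shows "\<exists>i. i \<in>\<^sub>V \<kappa> \<and> nth' \<sigma> i x"
proof -
  obtain \<eta> f where f: "enum f \<eta> (reps' \<sigma>)" using ex_enum[of "reps' \<sigma>"] reps_Ord by blast
  then obtain i where i: "opair i x \<in>\<^sub>V f" using assms unfolding enum_def by blast
  have fn: "is_fun f \<eta> (reps' \<sigma>)" using f unfolding enum_def by blast
  have "i \<in>\<^sub>V \<eta>" using i unfolding opair_mem_iff[OF fn] by blast
  then show ?thesis using Ord_trans[OF Ord_\<kappa> enum_reps_length[OF f]] f i unfolding nth_rep_def by blast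
qed

text \<open>The null classes inject into \<open>vpow \<sigma>\<close>, so their number is below \<open>\<epsilon>\<close>.\<close>

lemma almost_in_positive_class:
  assumes "hartogs (vpow \<sigma>) \<in>\<^sub>V \<epsilon>"
  shows "almost \<delta> F (\<lambda>y. \<exists>x. x \<in>\<^sub>V reps' \<sigma> \<and> eqv \<sigma> x y)"
proof -
  define N where "N = Sep \<delta> (\<lambda>x. least_in_class \<sigma> x \<and> \<not> positive_class F \<sigma> x)"
  have N: "x \<in>\<^sub>V N \<longleftrightarrow> x \<in>\<^sub>V \<delta> \<and> least_in_class \<sigma> x \<and> \<not> positive_class F \<sigma> x" for x
    unfolding N_def by (rule mem_Sep) (intro fo_rules)
  have N_Ord: "Ord x" if "x \<in>\<^sub>V N" for x using that Ord_mem[OF Ord_\<delta>] unfolding N by blast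
  obtain \<theta> f where f: "enum f \<theta> N" using ex_enum[OF N_Ord] by blast
  then have fn: "Ord \<theta>" "is_fun f \<theta> N" unfolding enum_def by blast+
  \<comment> \<open>A class is coded by the set C of those members of \<sigma> that contain its
    points.\<close>
  have "\<exists>g. is_inj g \<theta> (vpow \<sigma>) \<and> (\<forall>i C. opair i C \<in>\<^sub>V g \<longleftrightarrow> i \<in>\<^sub>V \<theta> \<and>
    (\<exists>x. opair i x \<in>\<^sub>V f \<and> (\<forall>A. A \<in>\<^sub>V C \<longleftrightarrow> A \<in>\<^sub>V \<sigma> \<and> x \<in>\<^sub>V A)))"
  proof (rule fun_rel_inj)
    fix i assume i: "i \<in>\<^sub>V \<theta>"
    have "A \<in>\<^sub>V Sep \<sigma> (\<lambda>A. app f i \<in>\<^sub>V A) \<longleftrightarrow> A \<in>\<^sub>V \<sigma> \<and> app f i \<in>\<^sub>V A" for A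
      by (rule mem_Sep) (intro fo_rules)
    moreover from this have "Sep \<sigma> (\<lambda>A. app f i \<in>\<^sub>V A) \<in>\<^sub>V vpow \<sigma>"
      unfolding mem_vpow vsubset_def by blast
    ultimately show "\<exists>C. C \<in>\<^sub>V vpow \<sigma> \<and> (\<exists>x. opair i x \<in>\<^sub>V f \<and> (\<forall>A. A \<in>\<^sub>V C \<longleftrightarrow> A \<in>\<^sub>V \<sigma> \<and> x \<in>\<^sub>V A))"
      using app_mem[OF fn(2) i] by blast
  next
    fix i C D
    assume "\<exists>x. opair i x \<in>\<^sub>V f \<and> (\<forall>A. A \<in>\<^sub>V C \<longleftrightarrow> A \<in>\<^sub>V \<sigma> \<and> x \<in>\<^sub>V A)"
      "\<exists>x. opair i x \<in>\<^sub>V f \<and> (\<forall>A. A \<in>\<^sub>V D \<longleftrightarrow> A \<in>\<^sub>V \<sigma> \<and> x \<in>\<^sub>V A)"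
    then show "C = D"
      unfolding opair_mem_iff[OF fn(2)] by (intro eqI) blast
  next
    fix i j C
    assume "\<exists>x. opair i x \<in>\<^sub>V f \<and> (\<forall>A. A \<in>\<^sub>V C \<longleftrightarrow> A \<in>\<^sub>V \<sigma> \<and> x \<in>\<^sub>V A)"
      "\<exists>x. opair j x \<in>\<^sub>V f \<and> (\<forall>A. A \<in>\<^sub>V C \<longleftrightarrow> A \<in>\<^sub>V \<sigma> \<and> x \<in>\<^sub>V A)"
    then obtain x y where xy: "opair i x \<in>\<^sub>V f" "opair j y \<in>\<^sub>V f" "eqv \<sigma> x y"
      unfolding eqv_def by blast
    then have "x \<in>\<^sub>V N" "y \<in>\<^sub>V N" using app_mem[OF fn(2)] unfolding opair_mem_iff[OF fn(2)] by blast+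
    then have "x = y" using least_in_class_unique[OF N_Ord N_Ord _ _ xy(3)] unfolding N by blast
    then show "i = j" using enum_is_inj[OF f] xy unfolding is_inj_iff by blast
  qed (intro fo_rules)
  then have "\<theta> \<in>\<^sub>V \<epsilon>" using Ord_trans[OF Ord_\<epsilon> assms] mem_hartogs[OF fn(1)] by blast
  have "almost \<delta> F (\<lambda>y. \<forall>x. opair i x \<in>\<^sub>V f \<longrightarrow> \<not> eqv \<sigma> x y)" if "i \<in>\<^sub>V \<theta>" for i
  proof -
    have "\<not> positive_class F \<sigma> (app f i)" using app_mem[OF fn(2) that] unfolding N by blast
    then obtain B where B: "B \<in>\<^sub>V F" "\<And>y. y \<in>\<^sub>V B \<Longrightarrow> \<not> eqv \<sigma> (app f i) y"
      unfolding positive_class_def by blast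
    have "almost \<delta> F (\<lambda>y. y \<in>\<^sub>V B)"
      using B(1) almost_mem_iff[OF filter_F filter_subset[OF filter_F]] by blast
    then show ?thesis
      by (rule almost_mono[OF filter_F], (intro fo_rules)+)
        (use B(2) in \<open>simp add: opair_mem_iff[OF fn(2)]\<close>)
  qed
  then have null: "almost \<delta> F (\<lambda>y. \<forall>i. i \<in>\<^sub>V \<theta> \<longrightarrow> (\<forall>x. opair i x \<in>\<^sub>V f \<longrightarrow> \<not> eqv \<sigma> x y))"
    by (intro almost_ball_complete[OF complete_F \<open>\<theta> \<in>\<^sub>V \<epsilon>\<close>] fo_rules)
  have "\<exists>x. x \<in>\<^sub>V reps' \<sigma> \<and> eqv \<sigma> x y"
    if y: "y \<in>\<^sub>V \<delta>" "\<forall>i. i \<in>\<^sub>V \<theta> \<longrightarrow> (\<forall>x. opair i x \<in>\<^sub>V f \<longrightarrow> \<not> eqv \<sigma> x y)" for y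
  proof -
    obtain x where x: "x \<in>\<^sub>V \<delta>" "eqv \<sigma> x y" "least_in_class \<sigma> x"
      using ex_least_in_class[OF y(1) Ord_\<delta>] by blast
    have "\<not> x \<in>\<^sub>V N"
      using y(2) f x(2) unfolding enum_def opair_mem_iff[OF fn(2)] by blast
    then show ?thesis using x unfolding N mem_reps by blast
  qed
  then show ?thesis
    by (intro almost_mono[OF filter_F null] fo_rules)
qed

section \<open>The limit ultrafilters and their intersection\<close>

lemma almost_contains: "A \<subseteq>\<^sub>V \<delta> \<Longrightarrow> almost (vpow (vpow \<delta>)) W (\<lambda>\<sigma>. A \<in>\<^sub>V \<sigma>)"
  using fine_W unfolding is_fine_def mem_vpow[of A \<delta>, symmetric] by blast

lemma lim_mono:
  assumes "lim' i A" "\<And>x. x \<in>\<^sub>V \<delta> \<Longrightarrow> x \<in>\<^sub>V A \<Longrightarrow> x \<in>\<^sub>V B" shows "lim' i B"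
  using assms(1) unfolding lim_mem_def
  by (rule almost_mono[OF filter_W _ fo_in_lim_mem fo_in_lim_mem])
    (use assms(2) nth_mem_reps in \<open>unfold mem_reps, blast\<close>)

lemma lim_inter:
  assumes "lim' i A" "lim' i B" "\<And>x. x \<in>\<^sub>V \<delta> \<Longrightarrow> x \<in>\<^sub>V A \<Longrightarrow> x \<in>\<^sub>V B \<Longrightarrow> x \<in>\<^sub>V C" shows "lim' i C"
  unfolding lim_mem_def
proof (rule almost_mono[OF filter_W almost_conj[OF filter_W assms(1,2)[unfolded lim_mem_def]
        fo_in_lim_mem fo_in_lim_mem] fo_and[OF fo_in_lim_mem fo_in_lim_mem] fo_in_lim_mem])
  fix \<sigma> assume "(\<exists>x. nth' \<sigma> i x \<and> x \<in>\<^sub>V A) \<and> (\<exists>x. nth' \<sigma> i x \<and> x \<in>\<^sub>V B)"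
  then obtain x where x: "nth' \<sigma> i x" "x \<in>\<^sub>V A" "x \<in>\<^sub>V B" using nth_unique by blast
  moreover have "x \<in>\<^sub>V \<delta>" using nth_mem_reps[OF x(1)] unfolding mem_reps by blast
  ultimately show "\<exists>x. nth' \<sigma> i x \<and> x \<in>\<^sub>V C" using assms(3) by blast
qed

text \<open>\<open>lim' i \<delta>\<close> says that almost every \<sigma> has an i-th positive
  class; its representative then lies in \<open>A\<close> or outside it, and \<open>W\<close>
  decides which.\<close>

lemma lim_ultra:
  assumes "lim' i \<delta>" "\<not> lim' i A" "\<And>x. x \<in>\<^sub>V \<delta> \<Longrightarrow> \<not> x \<in>\<^sub>V A \<Longrightarrow> x \<in>\<^sub>V B" shows "lim' i B"
  unfolding lim_mem_def
proof (rule almost_mono[OF filter_W almost_conj[OF filter_W assms(1)[unfolded lim_mem_def]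
        almost_ultra[OF ultra_W fo_in_lim_mem assms(2)[unfolded lim_mem_def]]
        fo_in_lim_mem fo_not[OF fo_in_lim_mem]] fo_and[OF fo_in_lim_mem fo_not[OF fo_in_lim_mem]]
        fo_in_lim_mem])
  fix \<sigma> assume "(\<exists>x. nth' \<sigma> i x \<and> x \<in>\<^sub>V \<delta>) \<and> \<not> (\<exists>x. nth' \<sigma> i x \<and> x \<in>\<^sub>V A)"
  then show "\<exists>x. nth' \<sigma> i x \<and> x \<in>\<^sub>V B" using assms(3) by blast
qed

text \<open>By positivity the i-th class meets \<open>B\<close>. Once \<open>B\<close> is a member
  of \<sigma>, it cannot split the class, so the representative is in \<open>B\<close> too.\<close>

lemma lim_filter:
  assumes "lim' i \<delta>" "B \<in>\<^sub>V F" shows "lim' i B"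
  unfolding lim_mem_def
proof (rule almost_mono[OF filter_W almost_conj[OF filter_W assms(1)[unfolded lim_mem_def]
        almost_contains[OF filter_subset[OF filter_F assms(2)]] fo_in_lim_mem] _ fo_in_lim_mem])
  fix \<sigma> assume "(\<exists>x. nth' \<sigma> i x \<and> x \<in>\<^sub>V \<delta>) \<and> B \<in>\<^sub>V \<sigma>"
  then obtain x where x: "nth' \<sigma> i x" "B \<in>\<^sub>V \<sigma>" by blast
  then have "\<exists>y. y \<in>\<^sub>V B \<and> eqv \<sigma> x y"
    using nth_mem_reps[OF x(1)] assms(2) unfolding mem_reps positive_class_def by blast
  then show "\<exists>x. nth' \<sigma> i x \<and> x \<in>\<^sub>V B" using x unfolding eqv_def by blast
qed (intro fo_rules)+

text \<open>One \<sigma> can be found that contains \<open>A\<close> and has all its representatives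
  in \<open>A\<close>. Its positive classes are then included in \<open>A\<close>, and their union
  is in \<open>F\<close>.\<close>

lemma lim_all_filter:
  assumes A: "A \<subseteq>\<^sub>V \<delta>" and lim: "\<And>i. i \<in>\<^sub>V \<kappa> \<Longrightarrow> lim' i \<delta> \<Longrightarrow> lim' i A"
  shows "A \<in>\<^sub>V F"
proof -
  let ?Y = "vpow (vpow \<delta>)"
  have fo: "fo (\<lambda>e. \<forall>x. nth' (e 0) i x \<longrightarrow> x \<in>\<^sub>V A)" for i by (intro fo_rules)
  have "almost ?Y W (\<lambda>\<sigma>. \<forall>x. nth' \<sigma> i x \<longrightarrow> x \<in>\<^sub>V A)" if i: "i \<in>\<^sub>V \<kappa>" for i
  proof (cases "lim' i \<delta>")
    case True
    show ?thesis
      by (rule almost_mono[OF filter_W lim[OF i True, unfolded lim_mem_def] fo_in_lim_mem fo])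
        (use nth_unique in blast)
  next
    \<comment> \<open>Almost no \<sigma> has an i-th positive class, so the claim holds
      vacuously.\<close>
    case False
    show ?thesis
      by (rule almost_mono[OF filter_W almost_ultra[OF ultra_W fo_in_lim_mem
              False[unfolded lim_mem_def]] fo_not[OF fo_in_lim_mem] fo])
        (use nth_mem_reps in \<open>unfold mem_reps, blast\<close>)
  qed
  then have "almost ?Y W (\<lambda>\<sigma>. \<forall>i. i \<in>\<^sub>V \<kappa> \<longrightarrow> (\<forall>x. nth' \<sigma> i x \<longrightarrow> x \<in>\<^sub>V A))"
    by (intro almost_ball_complete[OF complete_W \<kappa>_\<nu>] fo_rules)
  from almost_conj[OF filter_W small almost_conj[OF filter_W almost_contains[OF A] this]]
  have "almost ?Y W (\<lambda>\<sigma>. hartogs (vpow \<sigma>) \<in>\<^sub>V \<epsilon> \<and> A \<in>\<^sub>V \<sigma> \<and>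
      (\<forall>i. i \<in>\<^sub>V \<kappa> \<longrightarrow> (\<forall>x. nth' \<sigma> i x \<longrightarrow> x \<in>\<^sub>V A)))"
    by this (intro fo_rules)+
  then have "\<exists>\<sigma>. \<sigma> \<in>\<^sub>V ?Y \<and> hartogs (vpow \<sigma>) \<in>\<^sub>V \<epsilon> \<and> A \<in>\<^sub>V \<sigma> \<and>
      (\<forall>i. i \<in>\<^sub>V \<kappa> \<longrightarrow> (\<forall>x. nth' \<sigma> i x \<longrightarrow> x \<in>\<^sub>V A))"
    by (rule almost_ex[OF filter_W]) (intro fo_rules)
  then obtain \<sigma> where \<sigma>: "hartogs (vpow \<sigma>) \<in>\<^sub>V \<epsilon>" "A \<in>\<^sub>V \<sigma>"
    "\<And>i x. i \<in>\<^sub>V \<kappa> \<Longrightarrow> nth' \<sigma> i x \<Longrightarrow> x \<in>\<^sub>V A" by blast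
  have "almost \<delta> F (\<lambda>y. y \<in>\<^sub>V A)"
    using almost_in_positive_class[OF \<sigma>(1)]
    by (rule almost_mono[OF filter_F], (intro fo_rules)+)
      (use \<sigma>(2,3) ex_nth in \<open>unfold eqv_def, blast\<close>)
  then show ?thesis using almost_mem_iff[OF filter_F A] by blast
qed

text \<open>The inclusion of the i-th limit in the j-th is the form in which \<open>is_atomI\<close>
  asks for agreement.\<close>

definition separated :: "'v \<Rightarrow> 'v \<Rightarrow> 'v \<Rightarrow> bool" where
  "separated i j \<sigma> \<longleftrightarrow> (\<forall>x. x \<in>\<^sub>V reps' \<sigma> \<longrightarrow> lim' i (eqv_class \<delta> \<sigma> x) \<longrightarrow> lim' j (eqv_class \<delta> \<sigma> x) \<longrightarrow>
    (\<forall>A. A \<subseteq>\<^sub>V \<delta> \<longrightarrow> lim' i A \<longrightarrow> lim' j A))"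

lemma fo_separated: "fot r \<Longrightarrow> fot s \<Longrightarrow> fot t \<Longrightarrow> fo (\<lambda>e. separated (r e) (s e) (t e))"
  by (rule fo_comp3[of separated]) (unfold separated_def, intro fo_rules)

text \<open>If \<open>A\<close> distinguishes the ultrafilters \<open>i\<close> and \<open>j\<close> then every \<open>\<sigma>\<close> containing \<open>A\<close> separates them.\<close>

lemma almost_separated: "almost (vpow (vpow \<delta>)) W (separated i j)"
proof (cases "\<forall>A. A \<subseteq>\<^sub>V \<delta> \<longrightarrow> lim' i A \<longrightarrow> lim' j A")
  case True
  then show ?thesis
    by (intro almost_all[OF filter_W] fo_separated fo_rules) (simp add: separated_def)
next
  case False
  then obtain A where A: "A \<subseteq>\<^sub>V \<delta>" "lim' i A" "\<not> lim' j A" by blast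
  show ?thesis
  proof (rule almost_mono[OF filter_W almost_contains[OF A(1)]])
    fix \<sigma> assume \<sigma>: "A \<in>\<^sub>V \<sigma>"
    \<comment> \<open>As \<open>A\<close> is a member of \<sigma>, the class of x is included in
      \<open>A\<close> or disjoint from it. The first contradicts the choice of \<open>A\<close> for
      j, the second that for i.\<close>
    have "False" if x: "lim' i (eqv_class \<delta> \<sigma> x)" "lim' j (eqv_class \<delta> \<sigma> x)" for x
    proof (cases "x \<in>\<^sub>V A")
      case True
      then have "lim' j A"
        using lim_mono[OF x(2), of A] \<sigma> unfolding mem_eqv_class eqv_def by blast
      with A(3) show False ..
    next
      case False
      have "lim' i (Sep \<delta> (\<lambda>_. False))"
        by (rule lim_inter[OF x(1) A(2)]) (use False \<sigma> in \<open>unfold mem_eqv_class eqv_def, blast\<close>)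
      then have "\<exists>\<sigma>. \<sigma> \<in>\<^sub>V vpow (vpow \<delta>) \<and> (\<exists>x. nth' \<sigma> i x \<and> x \<in>\<^sub>V Sep \<delta> (\<lambda>_. False))"
        unfolding lim_mem_def by (rule almost_ex[OF filter_W _ fo_in_lim_mem])
      then show False using mem_Sep[of "\<lambda>_. False" _ \<delta>] fo_const by blast
    qed
    then show "separated i j \<sigma>" unfolding separated_def by blast
  qed (intro fo_rules fo_separated)+
qed

text \<open>The limits containing \<open>A\<close> agree, and the filter generated by
  \<open>F\<close> and \<open>A\<close> is their common value, because \<open>F\<close> is the
  intersection of all limits.\<close>

lemma is_atomI:
  assumes A: "A \<subseteq>\<^sub>V \<delta>" and pos: "\<And>B. B \<in>\<^sub>V F \<Longrightarrow> \<exists>y. y \<in>\<^sub>V A \<and> y \<in>\<^sub>V B"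
    and coincide: "\<And>i j B. i \<in>\<^sub>V \<kappa> \<Longrightarrow> j \<in>\<^sub>V \<kappa> \<Longrightarrow> lim' i A \<Longrightarrow> lim' j A \<Longrightarrow> B \<subseteq>\<^sub>V \<delta> \<Longrightarrow> lim' i B \<Longrightarrow> lim' j B"
  shows "is_atom \<delta> F A"
proof -
  define G where "G = Sep (vpow \<delta>) (\<lambda>B. \<exists>C. C \<in>\<^sub>V F \<and> (\<forall>y. y \<in>\<^sub>V C \<longrightarrow> y \<in>\<^sub>V A \<longrightarrow> y \<in>\<^sub>V B))"
  have G: "B \<in>\<^sub>V G \<longleftrightarrow> B \<subseteq>\<^sub>V \<delta> \<and> (\<exists>C. C \<in>\<^sub>V F \<and> (\<forall>y. y \<in>\<^sub>V C \<longrightarrow> y \<in>\<^sub>V A \<longrightarrow> y \<in>\<^sub>V B))" for B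
    unfolding G_def mem_vpow[symmetric] by (rule mem_Sep) (intro fo_rules)
  have filter_G: "filter_on \<delta> G"
    unfolding filter_on_def
  proof (intro conjI allI impI)
    show "G \<subseteq>\<^sub>V vpow \<delta>" unfolding vsubset_def[of G] mem_vpow G by blast
    show "\<delta> \<in>\<^sub>V G" unfolding G using \<delta>_in_F F_sub by (auto simp: vsubset_def)
    show "nonempty B" if "B \<in>\<^sub>V G" for B
      using that pos unfolding G nonempty_def by blast
    show "C \<in>\<^sub>V G" if "B \<in>\<^sub>V G \<and> B \<subseteq>\<^sub>V C \<and> C \<subseteq>\<^sub>V \<delta>" for B C
      using that unfolding G by (auto simp: vsubset_def)
    fix B C assume "B \<in>\<^sub>V G \<and> C \<in>\<^sub>V G"
    then obtain B' C' where B': "B \<subseteq>\<^sub>V \<delta>" "B' \<in>\<^sub>V F" "\<And>y. y \<in>\<^sub>V B' \<Longrightarrow> y \<in>\<^sub>V A \<Longrightarrow> y \<in>\<^sub>V B"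
      and C': "C' \<in>\<^sub>V F" "\<And>y. y \<in>\<^sub>V C' \<Longrightarrow> y \<in>\<^sub>V A \<Longrightarrow> y \<in>\<^sub>V C" unfolding G by blast
    have "below B' C' \<in>\<^sub>V F" using filter_F B'(2) C'(1) unfolding filter_on_def by blast
    moreover have "below B C \<subseteq>\<^sub>V \<delta>" using B'(1) unfolding vsubset_def mem_below by blast
    moreover have "\<forall>y. y \<in>\<^sub>V below B' C' \<longrightarrow> y \<in>\<^sub>V A \<longrightarrow> y \<in>\<^sub>V below B C"
      using B'(3) C'(2) unfolding mem_below by blast
    ultimately show "below B C \<in>\<^sub>V G" unfolding G by blast
  qed
  have FA: "B \<in>\<^sub>V Coll (\<lambda>B. B \<in>\<^sub>V F \<or> B = A) \<longleftrightarrow> B \<in>\<^sub>V F \<or> B = A" for B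
  proof (rule mem_Coll_iff)
    have "B \<in>\<^sub>V Sep (vpow \<delta>) (\<lambda>B. B \<in>\<^sub>V F \<or> B = A) \<longleftrightarrow> B \<in>\<^sub>V vpow \<delta> \<and> (B \<in>\<^sub>V F \<or> B = A)" for B
      by (rule mem_Sep) (intro fo_rules)
    then show "\<exists>b. \<forall>B. B \<in>\<^sub>V b \<longleftrightarrow> B \<in>\<^sub>V F \<or> B = A"
      using A filter_subset[OF filter_F] unfolding mem_vpow by blast
  qed
  have gen: "is_generated_filter \<delta> (Coll (\<lambda>B. B \<in>\<^sub>V F \<or> B = A)) G"
    unfolding is_generated_filter_def
  proof (intro conjI allI impI filter_G)
    show "Coll (\<lambda>B. B \<in>\<^sub>V F \<or> B = A) \<subseteq>\<^sub>V G"
      unfolding vsubset_def[of _ G] FA G using A \<delta>_in_F filter_subset[OF filter_F] by blast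
    fix H assume H: "filter_on \<delta> H \<and> Coll (\<lambda>B. B \<in>\<^sub>V F \<or> B = A) \<subseteq>\<^sub>V H"
    then have FH: "\<And>B. B \<in>\<^sub>V F \<Longrightarrow> B \<in>\<^sub>V H" and AH: "A \<in>\<^sub>V H" unfolding vsubset_def[of _ H] FA by blast+
    show "G \<subseteq>\<^sub>V H"
    proof (rule vsubsetI)
      fix B assume "B \<in>\<^sub>V G"
      then obtain C where C: "B \<subseteq>\<^sub>V \<delta>" "C \<in>\<^sub>V F" "\<And>y. y \<in>\<^sub>V C \<Longrightarrow> y \<in>\<^sub>V A \<Longrightarrow> y \<in>\<^sub>V B" unfolding G by blast
      have "below C A \<in>\<^sub>V H" using H FH[OF C(2)] AH unfolding filter_on_def by blast
      moreover have "below C A \<subseteq>\<^sub>V B" using C(3) unfolding vsubset_def mem_below by blast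
      ultimately show "B \<in>\<^sub>V H" using H C(1) unfolding filter_on_def by blast
    qed
  qed
  define A' where "A' = Sep \<delta> (\<lambda>y. \<not> y \<in>\<^sub>V A)"
  have A': "y \<in>\<^sub>V A' \<longleftrightarrow> y \<in>\<^sub>V \<delta> \<and> \<not> y \<in>\<^sub>V A" for y
    unfolding A'_def by (rule mem_Sep) (intro fo_rules)
  \<comment> \<open>Since \<open>A\<close> meets every member of \<open>F\<close>, its complement is
    not in \<open>F\<close>. Some limit therefore omits the complement and contains
    \<open>A\<close>.\<close>
  have "\<not> A' \<in>\<^sub>V F" using pos[of A'] unfolding A' by blast
  moreover have "A' \<subseteq>\<^sub>V \<delta>" unfolding vsubset_def A' by blast
  ultimately obtain i where i: "i \<in>\<^sub>V \<kappa>" "lim' i \<delta>" "\<not> lim' i A'" using lim_all_filter by blast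
  then have iA: "lim' i A" using lim_ultra[OF i(2,3), of A] unfolding A' by blast
  have inG: "B \<in>\<^sub>V G" if B: "B \<subseteq>\<^sub>V \<delta>" "lim' i B" for B
  proof -
    \<comment> \<open>The union of \<open>B\<close> with the complement of \<open>A\<close> is in
      every limit: in those containing \<open>A\<close> because of \<open>B\<close>, in the others
      because of the complement.\<close>
    define C where "C = Sep \<delta> (\<lambda>y. y \<in>\<^sub>V A \<longrightarrow> y \<in>\<^sub>V B)"
    have C: "y \<in>\<^sub>V C \<longleftrightarrow> y \<in>\<^sub>V \<delta> \<and> (y \<in>\<^sub>V A \<longrightarrow> y \<in>\<^sub>V B)" for y
      unfolding C_def by (rule mem_Sep) (intro fo_rules)
    have "C \<in>\<^sub>V F"
    proof (rule lim_all_filter)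
      show "C \<subseteq>\<^sub>V \<delta>" unfolding vsubset_def C by blast
      fix j assume j: "j \<in>\<^sub>V \<kappa>" "lim' j \<delta>"
      show "lim' j C"
      proof (cases "lim' j A")
        case True
        show ?thesis
          by (rule lim_mono[OF coincide[OF i(1) j(1) iA True B]]) (unfold C, blast)
      next
        case False
        show ?thesis by (rule lim_ultra[OF j(2) False]) (unfold C, blast)
      qed
    qed
    then show ?thesis unfolding G using B(1) C by blast
  qed
  have "ultrafilter_on \<delta> G"
    unfolding ultrafilter_on_def
  proof (intro conjI allI impI filter_G)
    fix B assume B: "B \<subseteq>\<^sub>V \<delta>"
    have B': "y \<in>\<^sub>V Sep \<delta> (\<lambda>x. \<not> x \<in>\<^sub>V B) \<longleftrightarrow> y \<in>\<^sub>V \<delta> \<and> \<not> y \<in>\<^sub>V B" for y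
      by (rule mem_Sep) (intro fo_rules)
    then have sub: "Sep \<delta> (\<lambda>x. \<not> x \<in>\<^sub>V B) \<subseteq>\<^sub>V \<delta>" unfolding vsubset_def by blast
    show "B \<in>\<^sub>V G \<or> Sep \<delta> (\<lambda>x. \<not> x \<in>\<^sub>V B) \<in>\<^sub>V G"
    proof (cases "lim' i B")
      case True
      then show ?thesis using inG[OF B] by blast
    next
      case False
      have "lim' i (Sep \<delta> (\<lambda>x. \<not> x \<in>\<^sub>V B))"
        by (rule lim_ultra[OF i(2) False]) (unfold B', blast)
      then show ?thesis using inG[OF sub] by blast
    qed
  qed
  then show ?thesis unfolding is_atom_def is_positive_def using A pos gen by blast
qed

section \<open>The partition into atoms\<close>

lemma atomic_partition:
  "\<exists>P. is_partition \<delta> P \<and> (\<forall>A. A \<in>\<^sub>V P \<longrightarrow> is_atom \<delta> F A) \<and> (\<exists>\<mu> f. \<mu> \<in>\<^sub>V \<kappa> \<and> is_bij f \<mu> P)"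
proof -
  have "almost (vpow (vpow \<delta>)) W (\<lambda>\<sigma>. \<forall>i. i \<in>\<^sub>V \<kappa> \<longrightarrow> (\<forall>j. j \<in>\<^sub>V \<kappa> \<longrightarrow> separated i j \<sigma>))"
    by (intro almost_ball_complete[OF complete_W \<kappa>_\<nu>] almost_separated fo_rules fo_separated)
  from almost_conj[OF filter_W small this]
  have "almost (vpow (vpow \<delta>)) W (\<lambda>\<sigma>. hartogs (vpow \<sigma>) \<in>\<^sub>V \<epsilon> \<and>
      (\<forall>i. i \<in>\<^sub>V \<kappa> \<longrightarrow> (\<forall>j. j \<in>\<^sub>V \<kappa> \<longrightarrow> separated i j \<sigma>)))"
    by this (intro fo_rules fo_separated)+
  then have "\<exists>\<sigma>. \<sigma> \<in>\<^sub>V vpow (vpow \<delta>) \<and> hartogs (vpow \<sigma>) \<in>\<^sub>V \<epsilon> \<and>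
      (\<forall>i. i \<in>\<^sub>V \<kappa> \<longrightarrow> (\<forall>j. j \<in>\<^sub>V \<kappa> \<longrightarrow> separated i j \<sigma>))"
    by (rule almost_ex[OF filter_W]) (intro fo_rules fo_separated)
  then obtain \<sigma> where hart: "hartogs (vpow \<sigma>) \<in>\<^sub>V \<epsilon>"
    and sep: "\<And>i j. i \<in>\<^sub>V \<kappa> \<Longrightarrow> j \<in>\<^sub>V \<kappa> \<Longrightarrow> separated i j \<sigma>" by blast
  define Q where "Q = Sep \<delta> (\<lambda>y. \<exists>x. x \<in>\<^sub>V reps' \<sigma> \<and> eqv \<sigma> x y)"
  have Q: "y \<in>\<^sub>V Q \<longleftrightarrow> y \<in>\<^sub>V \<delta> \<and> (\<exists>x. x \<in>\<^sub>V reps' \<sigma> \<and> eqv \<sigma> x y)" for y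
    unfolding Q_def by (rule mem_Sep) (intro fo_rules)
  have QF: "Q \<in>\<^sub>V F" unfolding Q_def by (rule almost_in_positive_class[OF hart])
  then have "nonempty Q" using filter_F unfolding filter_on_def by blast
  then obtain x0 where x0: "x0 \<in>\<^sub>V reps' \<sigma>" unfolding nonempty_def Q by blast
  \<comment> \<open>The null classes fill the complement of \<open>Q\<close>; the piece of
    \<open>x0\<close> absorbs them, so that the pieces cover \<delta>.\<close>
  define piece where "piece x = Sep \<delta> (\<lambda>y. eqv \<sigma> x y \<or> x = x0 \<and> \<not> y \<in>\<^sub>V Q)" for x
  have piece: "y \<in>\<^sub>V piece x \<longleftrightarrow> y \<in>\<^sub>V \<delta> \<and> (eqv \<sigma> x y \<or> x = x0 \<and> \<not> y \<in>\<^sub>V Q)" for x y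
    unfolding piece_def by (rule mem_Sep) (intro fo_rules)
  have fot_piece: "fot s \<Longrightarrow> fot (\<lambda>e. piece (s e))" for s
    by (rule fot_comp1[of piece]) (unfold piece_def, intro fo_rules)
  have piece_sub: "piece x \<subseteq>\<^sub>V \<delta>" for x unfolding vsubset_def piece by blast
  have in_piece: "x \<in>\<^sub>V piece x" if "x \<in>\<^sub>V reps' \<sigma>" for x
    using that eqv_refl unfolding piece mem_reps by blast
  have disj: "x = z" if x: "x \<in>\<^sub>V reps' \<sigma>" and z: "z \<in>\<^sub>V reps' \<sigma>" and y: "y \<in>\<^sub>V piece x" "y \<in>\<^sub>V piece z" for x y z
  proof (cases "eqv \<sigma> x y \<or> eqv \<sigma> z y")
    case True
    then have "y \<in>\<^sub>V Q" using x z y unfolding piece Q by blast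
    then have "eqv \<sigma> x y" "eqv \<sigma> z y" using y unfolding piece by blast+
    then show ?thesis using reps_unique[OF x z] eqv_trans eqv_sym by blast
  next
    case False
    then show ?thesis using y unfolding piece by blast
  qed
  define P where "P = Sep (vpow \<delta>) (\<lambda>A. \<exists>x. x \<in>\<^sub>V reps' \<sigma> \<and> A = piece x)"
  have P: "A \<in>\<^sub>V P \<longleftrightarrow> (\<exists>x. x \<in>\<^sub>V reps' \<sigma> \<and> A = piece x)" for A
  proof -
    have "A \<in>\<^sub>V P \<longleftrightarrow> A \<in>\<^sub>V vpow \<delta> \<and> (\<exists>x. x \<in>\<^sub>V reps' \<sigma> \<and> A = piece x)"
      unfolding P_def by (rule mem_Sep) (intro fo_rules fot_piece)
    then show ?thesis using piece_sub unfolding mem_vpow by blast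
  qed
  have partition: "is_partition \<delta> P"
    unfolding is_partition_def
  proof (intro conjI allI impI)
    show "A \<subseteq>\<^sub>V \<delta>" if "A \<in>\<^sub>V P" for A using that piece_sub unfolding P by blast
    show "nonempty A" if "A \<in>\<^sub>V P" for A using that in_piece unfolding P nonempty_def by blast
    show "\<not> (\<exists>y. y \<in>\<^sub>V A \<and> y \<in>\<^sub>V B)" if "A \<in>\<^sub>V P \<and> B \<in>\<^sub>V P \<and> A \<noteq> B" for A B
      using that disj unfolding P by blast
    show "\<exists>A. A \<in>\<^sub>V P \<and> y \<in>\<^sub>V A" if y: "y \<in>\<^sub>V \<delta>" for y
    proof (cases "y \<in>\<^sub>V Q")
      case True
      then obtain x where "x \<in>\<^sub>V reps' \<sigma>" "y \<in>\<^sub>V piece x" unfolding piece Q by blast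
      then show ?thesis unfolding P by blast
    next
      case False
      then have "y \<in>\<^sub>V piece x0" using y unfolding piece by blast
      then show ?thesis using x0 unfolding P by blast
    qed
  qed
  have atom: "is_atom \<delta> F (piece x)" if x: "x \<in>\<^sub>V reps' \<sigma>" for x
  proof (rule is_atomI[OF piece_sub])
    show "\<exists>y. y \<in>\<^sub>V piece x \<and> y \<in>\<^sub>V B" if "B \<in>\<^sub>V F" for B
      using that x F_sub[OF that] unfolding piece mem_reps positive_class_def by blast
    \<comment> \<open>\<open>Q\<close> is in \<open>F\<close> and so in every limit; intersecting
      with it cuts a piece down to its positive class, to which \<open>separated\<close>
      applies.\<close>
    have "lim' i (eqv_class \<delta> \<sigma> x)" if "lim' i (piece x)" for i
    proof (rule lim_inter[OF that lim_filter[OF _ QF]])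
      show "lim' i \<delta>" by (rule lim_mono[OF that])
      show "y \<in>\<^sub>V eqv_class \<delta> \<sigma> x" if "y \<in>\<^sub>V \<delta>" "y \<in>\<^sub>V piece x" "y \<in>\<^sub>V Q" for y
        using that unfolding piece mem_eqv_class by blast
    qed
    then show "lim' j B" if "i \<in>\<^sub>V \<kappa>" "j \<in>\<^sub>V \<kappa>" "lim' i (piece x)" "lim' j (piece x)" "B \<subseteq>\<^sub>V \<delta>" "lim' i B" for i j B
      using that x sep[OF that(1,2)] unfolding separated_def by blast
  qed
  obtain \<eta> f where f: "enum f \<eta> (reps' \<sigma>)" using ex_enum[of "reps' \<sigma>"] reps_Ord by blast
  then have fn: "is_fun f \<eta> (reps' \<sigma>)" unfolding enum_def by blast
  have inj: "i = j" if "opair i x \<in>\<^sub>V f" "opair j x \<in>\<^sub>V f" for i j x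
    using enum_is_inj[OF f] that unfolding is_inj_iff by blast
  have mem: "x \<in>\<^sub>V reps' \<sigma>" if "opair i x \<in>\<^sub>V f" for i x
    using that app_mem[OF fn] unfolding opair_mem_iff[OF fn] by blast
  have "\<exists>g. is_inj g \<eta> P \<and> (\<forall>i A. opair i A \<in>\<^sub>V g \<longleftrightarrow> i \<in>\<^sub>V \<eta> \<and> (\<exists>x. opair i x \<in>\<^sub>V f \<and> A = piece x))"
  proof (rule fun_rel_inj)
    show "\<exists>A. A \<in>\<^sub>V P \<and> (\<exists>x. opair i x \<in>\<^sub>V f \<and> A = piece x)" if "i \<in>\<^sub>V \<eta>" for i
      using app_mem[OF fn that] unfolding P by blast
    show "A = B" if "\<exists>x. opair i x \<in>\<^sub>V f \<and> A = piece x" "\<exists>x. opair i x \<in>\<^sub>V f \<and> B = piece x" for i A B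
      using that unfolding opair_mem_iff[OF fn] by blast
    show "i = j" if ex: "\<exists>x. opair i x \<in>\<^sub>V f \<and> A = piece x" "\<exists>x. opair j x \<in>\<^sub>V f \<and> A = piece x" for i j A
    proof -
      obtain x y where xy: "opair i x \<in>\<^sub>V f" "opair j y \<in>\<^sub>V f" "piece x = piece y" using ex by blast
      then have "x = y" using disj[OF mem mem in_piece] in_piece mem by metis
      then show ?thesis using xy inj by blast
    qed
  qed (intro fo_rules fot_piece)
  then obtain g where g: "is_inj g \<eta> P"
    "\<And>i A. opair i A \<in>\<^sub>V g \<longleftrightarrow> i \<in>\<^sub>V \<eta> \<and> (\<exists>x. opair i x \<in>\<^sub>V f \<and> A = piece x)" by blast
  have "\<exists>i. opair i A \<in>\<^sub>V g" if "A \<in>\<^sub>V P" for A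
    using that f unfolding g(2) P enum_def opair_mem_iff[OF fn] by blast
  then have "is_bij g \<eta> P" using g(1) unfolding is_bij_iff by blast
  moreover have "\<forall>A. A \<in>\<^sub>V P \<longrightarrow> is_atom \<delta> F A" using atom unfolding P by blast
  ultimately show ?thesis using partition enum_reps_length[OF f] by blast
qed

end

theorem theorem3p12:
  fixes \<delta> \<epsilon> U F W :: "'v::zf"
  assumes "Ord \<delta>" and "Ord \<epsilon>"
    and "ultrafilter_on (vpow \<delta>) U"
    and "\<not> is_principal (vpow \<delta>) U"
    and "is_normal \<delta> U"
    and "is_fine \<delta> U"
    and "filter_on \<delta> F"
    and "is_complete \<delta> F \<epsilon>"
    and "F \<in>\<^sub>V U"
    and "ultrafilter_on (vpow (vpow \<delta>)) W"
    and "is_wellfounded_filter (vpow (vpow \<delta>)) W"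
    and "is_complete (vpow (vpow \<delta>)) W (card_succ (completeness (vpow \<delta>) U))"
    and "is_fine (vpow \<delta>) W"
    and "Sep (vpow (vpow \<delta>)) (\<lambda>\<sigma>. hartogs (vpow \<sigma>) \<in>\<^sub>V \<epsilon>) \<in>\<^sub>V W"
  shows "\<exists>P. is_partition \<delta> P \<and> (\<forall>A. A \<in>\<^sub>V P \<longrightarrow> is_atom \<delta> F A) \<and>
    (\<exists>\<mu> f. \<mu> \<in>\<^sub>V completeness (vpow \<delta>) U \<and> is_bij f \<mu> P)"
proof -
  note \<kappa> = completeness_works[OF assms(1) nonprincipal_fine_incomplete[OF assms(3,4,6)]]
  interpret normal_and_fine_ultrafilters \<delta> \<epsilon> U F W "completeness (vpow \<delta>) U"
    "card_succ (completeness (vpow \<delta>) U)"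
    by unfold_locales (fact assms \<kappa> mem_card_succ[OF \<kappa>(1)])+
  show ?thesis by (rule atomic_partition)
qed

end
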